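(* Let $G$ be a finitely generated group. Assume that $G$ acts by homeomorphisms $g\mapsto\Phi_g$ on a compact Hausdorff space $X$, and that $\nu$ is a Borel probability measure on $X$ whose measure class is preserved by the action, with Radon-Nikodym derivatives $\rho_g=\frac{dg^*\nu}{d\nu}$ ($g\in G$), where $\rho_s\in L_\infty(X,\nu)$ for every $s$ in a fixed finite symmetric generating set $S$ of $G$. Put $\overline{\rho}(x)=\sup_{g\in G}\rho_g(x)$ and $\underline{\rho}(x)=\inf_{g\in G}\rho_g(x)$. Suppose that at least one of the following conditions holds: \begin{enumerate} \item $\overline{\rho}\in L_1(X,\nu)$; \item $\int_X\underline{\rho}(x)\,d\nu>0$. \end{enumerate} If $G$ is not a-T-menable, then the action of $G$ on $X$ is not topologically amenable.
   Context: Let $S$ be a finite symmetric ($S=S^{-1}$) generating set of $G$ and let $|\cdot|$ be the associated word length function. Radon-Nikodym derivatives: for $f:X\to\mathbb{R}$ write $(g*f)(x)=f(\Phi_{g^{-1}}(x))$. The measure $g^*\nu$ is the translate $g^*\nu(E)=\nu(\Phi_{g^{-1}}(E))$. That the measure class is preserved means that $g^*\nu$ and $\nu$ are mutually absolutely continuous for every $g\in G$. The derivative $\rho_g=dg^*\nu/d\nu$ thus satisfies $\int_X (g*f)\,\rho_g\,d\nu=\int_X f\,d\nu$. Topological amenability: let $\mathbb{F}$ be the space of functions $\xi:G\to C(X)$, $g\mapsto\xi_g$, with $\xi_g=0$ for all but finitely many $g$. For $\xi,\eta\in\mathbb{F}$ put $\langle\xi,\eta\rangle_{C(X)}(x)=\sum_{g\in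 G}\xi_g(x)\eta_g(x)$ and $(L_g\xi)_h(x)=\xi_{g^{-1}h}(\Phi_{g^{-1}}(x))$. The action of $G$ on $X$ is topologically amenable if for every $\varepsilon>0$ there is $\xi\in\mathbb{F}$ such that (a) $\xi_g\ge 0$ for every $g\in G$; (b) $\langle\xi,\xi\rangle_{C(X)}=1_X$; (c) $\sup_{x\in X}\left(1-\frac{1}{\#S}\sum_{s\in S}\langle\xi,L_s\xi\rangle_{C(X)}(x)\right)\le\varepsilon$. (This does not depend on the choice of $S$.) a-T-menability: an affine isometric action of $G$ on a Hilbert space $E$ is an action of the form $A_gv=\pi_gv+b_g$, where $\pi$ is a representation of $G$ by linear (surjective) isometries of $E$ and $b:G\to E$ satisfies $b_{gh}=\pi_gb_h+b_g$ for all $g,h\in G$. It is metrically proper if $\lim_{|g|\to\infty}\|A_gv\|=\infty$ for every $v\in E$, equivalently $\lim_{|g|\to\infty}\|b_g\|=\infty$. The group $G$ is a-T-menable (has the Haagerup property) if it admits a metrically proper affine isometric action on a Hilbert space. *)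

theory Defs
  imports "HOL-Probability.Probability" "HOL-Algebra.Module" "HOL-Algebra.Group_Action"
    "HOL-Algebra.Generated_Groups"
begin

section \<open>Real Hilbert spaces with explicit carriers\<close>

text \<open>
  The type class of complete inner product spaces cannot be used for the Hilbert spaces in the
  definition of a-T-menability, which quantifies existentially over them. They are therefore
  modules over the reals in the sense of the algebra library, with an additional inner product
  (the ring product and unit of the record are ignored).
\<close>

definition real_ring :: "real ring"
  where "real_ring = \<lparr>carrier = UNIV, mult = (*), one = 1, zero = 0, add = (+)\<rparr>"

record 'e hilbert = "(real, 'e) module" +
  hinner :: "'e \<Rightarrow> 'e \<Rightarrow> real"

definition hnorm :: "('e, 'm) hilbert_scheme \<Rightarrow> 'e \<Rightarrow> real"
  where "hnorm E v = sqrt (hinner E v v)"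

locale real_hilbert = module real_ring E for E :: "('e, 'm) hilbert_scheme" (structure) +
  assumes hinner_commute:
      "\<lbrakk>u \<in> carrier E; v \<in> carrier E\<rbrakk> \<Longrightarrow> hinner E u v = hinner E v u"
    and hinner_add_left:
      "\<lbrakk>u \<in> carrier E; v \<in> carrier E; w \<in> carrier E\<rbrakk>
        \<Longrightarrow> hinner E (u \<oplus> v) w = hinner E u w + hinner E v w"
    and hinner_smult_left:
      "\<lbrakk>u \<in> carrier E; v \<in> carrier E\<rbrakk> \<Longrightarrow> hinner E (c \<odot> u) v = c * hinner E u v"
    and hinner_pos: "\<lbrakk>v \<in> carrier E; v \<noteq> \<zero>\<rbrakk> \<Longrightarrow> hinner E v v > 0"
    and complete:
      "\<lbrakk>\<And>n. \<sigma> n \<in> carrier E;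
        \<And>\<epsilon>. \<epsilon> > 0 \<Longrightarrow> \<exists>N. \<forall>m\<ge>N. \<forall>n\<ge>N. hnorm E (\<sigma> m \<ominus> \<sigma> n) < \<epsilon>\<rbrakk>
        \<Longrightarrow> \<exists>l\<in>carrier E. (\<lambda>n. hnorm E (\<sigma> n \<ominus> l)) \<longlonglongrightarrow> 0"

section \<open>Affine isometric actions and a-T-menability\<close>

definition word_length :: "('g, 'm) monoid_scheme \<Rightarrow> 'g set \<Rightarrow> 'g \<Rightarrow> nat"
  where "word_length G S g =
    (LEAST n. \<exists>ws. set ws \<subseteq> S \<and> length ws = n \<and> foldr (\<otimes>\<^bsub>G\<^esub>) ws \<one>\<^bsub>G\<^esub> = g)"

text \<open>The filter \<open>|g| \<rightarrow> \<infinity>\<close> on \<open>carrier G\<close>.\<close>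

definition word_length_at_top :: "('g, 'm) monoid_scheme \<Rightarrow> 'g set \<Rightarrow> 'g filter"
  where "word_length_at_top G S =
    inf (filtercomap (word_length G S) at_top) (principal (carrier G))"

definition linear_surjective_isometry :: "('e, 'm) hilbert_scheme \<Rightarrow> ('e \<Rightarrow> 'e) \<Rightarrow> bool"
  where "linear_surjective_isometry E T \<longleftrightarrow>
    T ` carrier E = carrier E \<and>
    (\<forall>u\<in>carrier E. \<forall>v\<in>carrier E. T (u \<oplus>\<^bsub>E\<^esub> v) = T u \<oplus>\<^bsub>E\<^esub> T v) \<and>
    (\<forall>c. \<forall>v\<in>carrier E. T (c \<odot>\<^bsub>E\<^esub> v) = c \<odot>\<^bsub>E\<^esub> T v) \<and>
    (\<forall>v\<in>carrier E. hnorm E (T v) = hnorm E v)"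

definition affine_isometric_action ::
    "('g, 'n) monoid_scheme \<Rightarrow> ('e, 'm) hilbert_scheme \<Rightarrow> ('g \<Rightarrow> 'e \<Rightarrow> 'e) \<Rightarrow> ('g \<Rightarrow> 'e) \<Rightarrow> bool"
  where "affine_isometric_action G E \<pi> b \<longleftrightarrow>
    (\<forall>g\<in>carrier G. linear_surjective_isometry E (\<pi> g)) \<and>
    (\<forall>v\<in>carrier E. \<pi> \<one>\<^bsub>G\<^esub> v = v) \<and>
    (\<forall>g\<in>carrier G. \<forall>h\<in>carrier G. \<forall>v\<in>carrier E. \<pi> (g \<otimes>\<^bsub>G\<^esub> h) v = \<pi> g (\<pi> h v)) \<and>
    (\<forall>g\<in>carrier G. b g \<in> carrier E) \<and>
    (\<forall>g\<in>carrier G. \<forall>h\<in>carrier G. b (g \<otimes>\<^bsub>G\<^esub> h) = \<pi> g (b h) \<oplus>\<^bsub>E\<^esub> b g)"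

definition metrically_proper ::
    "('g, 'n) monoid_scheme \<Rightarrow> 'g set \<Rightarrow> ('e, 'm) hilbert_scheme \<Rightarrow> ('g \<Rightarrow> 'e \<Rightarrow> 'e) \<Rightarrow> ('g \<Rightarrow> 'e) \<Rightarrow> bool"
  where "metrically_proper G S E \<pi> b \<longleftrightarrow>
    (\<forall>v\<in>carrier E. filterlim (\<lambda>g. hnorm E (\<pi> g v \<oplus>\<^bsub>E\<^esub> b g)) at_top (word_length_at_top G S))"

text \<open>
  HOL has no quantification over types, so the elements of the Hilbert space are taken from the
  type \<open>'g \<Rightarrow> real\<close>; the Hilbert space structure is otherwise arbitrary. This is no restriction:
  by \<open>a_T_menableI\<close> below, a metrically proper affine isometric action on a Hilbert space over any
  type whatsoever yields one of this form.
\<close>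

definition a_T_menable :: "('g, 'n) monoid_scheme \<Rightarrow> 'g set \<Rightarrow> bool"
  where "a_T_menable G S \<longleftrightarrow>
    (\<exists>(E :: ('g \<Rightarrow> real) hilbert) \<pi> b.
      real_hilbert E \<and> affine_isometric_action G E \<pi> b \<and> metrically_proper G S E \<pi> b)"

section \<open>Independence of the universe\<close>

lemma real_ring_simps [simp]:
  "carrier real_ring = UNIV" "x \<otimes>\<^bsub>real_ring\<^esub> y = x * y" "\<one>\<^bsub>real_ring\<^esub> = 1"
  "\<zero>\<^bsub>real_ring\<^esub> = 0" "x \<oplus>\<^bsub>real_ring\<^esub> y = x + y"
  by (simp_all add: real_ring_def)

lemma cring_real_ring: "cring real_ring"
proof (rule cringI)
  show "abelian_group real_ring"
  proof (rule abelian_groupI)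
    show "\<exists>y\<in>carrier real_ring. y \<oplus>\<^bsub>real_ring\<^esub> x = \<zero>\<^bsub>real_ring\<^esub>" for x
      by (auto intro: exI[of _ "- x"])
  qed auto
  show "comm_monoid real_ring"
    by (rule comm_monoidI) (auto simp: algebra_simps)
qed (simp add: algebra_simps)

lemma a_inv_real_ring [simp]: "\<ominus>\<^bsub>real_ring\<^esub> x = - x"
proof -
  interpret cring real_ring by (rule cring_real_ring)
  show ?thesis by (rule minus_equality) auto
qed

context real_hilbert
begin

lemma minus_eq_smult: "\<lbrakk>u \<in> carrier E; v \<in> carrier E\<rbrakk> \<Longrightarrow> u \<ominus> v = u \<oplus> (- 1) \<odot> v"
  using smult_l_minus[of 1 v] smult_one[of v] by (simp add: a_minus_def)

lemma hinner_add_right: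
  "\<lbrakk>u \<in> carrier E; v \<in> carrier E; w \<in> carrier E\<rbrakk> \<Longrightarrow> hinner E w (u \<oplus> v) = hinner E w u + hinner E w v"
  by (metis M.a_closed hinner_add_left hinner_commute)

lemma smult_closed' [simp]: "v \<in> carrier E \<Longrightarrow> c \<odot> v \<in> carrier E"
  by (rule smult_closed) auto

lemma hinner_smult_right:
  "\<lbrakk>u \<in> carrier E; v \<in> carrier E\<rbrakk> \<Longrightarrow> hinner E u (c \<odot> v) = c * hinner E u v"
  by (metis smult_closed' hinner_smult_left hinner_commute)

lemma smult_zero_left [simp]: "v \<in> carrier E \<Longrightarrow> 0 \<odot> v = \<zero>"
  using smult_l_null[of v] by simp

lemma hinner_zero_left [simp]: "v \<in> carrier E \<Longrightarrow> hinner E \<zero> v = 0"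
  by (metis hinner_smult_left mult_zero_left smult_zero_left)

lemma hinner_zero_right [simp]: "v \<in> carrier E \<Longrightarrow> hinner E v \<zero> = 0"
  by (metis hinner_commute hinner_zero_left M.zero_closed)

lemma hinner_nonneg: "v \<in> carrier E \<Longrightarrow> hinner E v v \<ge> 0"
  using hinner_pos[of v] hinner_zero_left[of v] by (cases "v = \<zero>") auto

lemma hinner_minus_right:
  "\<lbrakk>u \<in> carrier E; v \<in> carrier E; w \<in> carrier E\<rbrakk> \<Longrightarrow> hinner E w (u \<ominus> v) = hinner E w u - hinner E w v"
  by (simp add: minus_eq_smult hinner_add_right hinner_smult_right)

lemma hnorm_power2: "v \<in> carrier E \<Longrightarrow> (hnorm E v)\<^sup>2 = hinner E v v"
  by (simp add: hnorm_def hinner_nonneg)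

lemma Cauchy_Schwarz:
  assumes u: "u \<in> carrier E" and v: "v \<in> carrier E"
  shows "\<bar>hinner E u v\<bar> \<le> hnorm E u * hnorm E v"
proof (cases "v = \<zero>")
  case True
  then show ?thesis using u by (simp add: hnorm_def)
next
  case False
  then have pos: "hinner E v v > 0" using v hinner_pos by blast
  define t where "t = hinner E u v / hinner E v v"
  have "0 \<le> hinner E (u \<oplus> (- t) \<odot> v) (u \<oplus> (- t) \<odot> v)"
    using u v by (simp add: hinner_nonneg)
  also have "\<dots> = hinner E u u - 2 * t * hinner E u v + t\<^sup>2 * hinner E v v"
    using u v by (simp add: hinner_add_left hinner_add_right hinner_smult_left
        hinner_smult_right hinner_commute[of v u] power2_eq_square algebra_simps)
  also have "\<dots> = hinner E u u - (hinner E u v)\<^sup>2 / hinner E v v"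
    using pos by (simp add: t_def power2_eq_square field_simps)
  finally have "(hinner E u v)\<^sup>2 \<le> hinner E u u * hinner E v v"
    using pos by (simp add: field_simps)
  then have "sqrt ((hinner E u v)\<^sup>2) \<le> sqrt (hinner E u u * hinner E v v)"
    by (rule real_sqrt_le_mono)
  then show ?thesis by (simp add: hnorm_def real_sqrt_mult)
qed

lemma real_hilbert_bicommutant_of_set:
  assumes W_def: "W = {v \<in> carrier E. \<forall>w\<in>carrier E. (\<forall>x\<in>B. hinner E w x = 0) \<longrightarrow> hinner E w v = 0}"
    and inj: "inj_on f W"
    and E'_def: "E' = \<lparr>carrier = f ` W, mult = m, one = i, zero = f \<zero>,
      add = (\<lambda>x y. f (inv_into W f x \<oplus> inv_into W f y)),
      smult = (\<lambda>c x. f (c \<odot> inv_into W f x)),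
      hinner = (\<lambda>x y. hinner E (inv_into W f x) (inv_into W f y))\<rparr>"
  shows "real_hilbert E'"
proof -
  have W: "v \<in> carrier E" if "v \<in> W" for v using that W_def by auto
  have W_add [simp]: "u \<oplus> v \<in> W" if "u \<in> W" "v \<in> W" for u v
    using that by (auto simp: W_def hinner_add_right)
  have W_smult [simp]: "c \<odot> v \<in> W" if "v \<in> W" for c v
    using that by (auto simp: W_def hinner_smult_right)
  have W_zero [simp]: "\<zero> \<in> W" by (auto simp: W_def)
  have inv [simp]: "inv_into W f (f v) = v" if "v \<in> W" for v
    using inj that by simp
  have c [simp]: "carrier E' = f ` W" and z [simp]: "\<zero>\<^bsub>E'\<^esub> = f \<zero>" by (simp_all add: E'_def)
  have a [simp]: "f u \<oplus>\<^bsub>E'\<^esub> f v = f (u \<oplus> v)" if "u \<in> W" "v \<in> W" for u v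
    using that by (simp add: E'_def)
  have s [simp]: "k \<odot>\<^bsub>E'\<^esub> f v = f (k \<odot> v)" if "v \<in> W" for k v
    using that by (simp add: E'_def)
  have h [simp]: "hinner E' (f u) (f v) = hinner E u v" if "u \<in> W" "v \<in> W" for u v
    using that by (simp add: E'_def)
  have ab: "abelian_group E'"
  proof (rule abelian_groupI)
    fix x assume "x \<in> carrier E'"
    then obtain v where v: "v \<in> W" "x = f v" by auto
    have "(- 1) \<odot> v \<oplus> v = \<zero>"
      using W[OF v(1)] smult_l_distr[of "- 1" 1 v] smult_one[of v] by simp
    then show "\<exists>y\<in>carrier E'. y \<oplus>\<^bsub>E'\<^esub> x = \<zero>\<^bsub>E'\<^esub>"
      using v by (auto intro!: bexI[of _ "(- 1) \<odot> v"])
  qed (auto simp: W M.a_ac)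
  interpret E': module real_ring E'
  proof (rule moduleI)
    show "cring real_ring" by (rule cring_real_ring)
    show "abelian_group E'" by (rule ab)
    fix r t :: real and x y assume "x \<in> carrier E'"
    then obtain v where v: "v \<in> W" "x = f v" by auto
    show "r \<odot>\<^bsub>E'\<^esub> x \<in> carrier E'" using v by simp
    show "(r \<oplus>\<^bsub>real_ring\<^esub> t) \<odot>\<^bsub>E'\<^esub> x = r \<odot>\<^bsub>E'\<^esub> x \<oplus>\<^bsub>E'\<^esub> t \<odot>\<^bsub>E'\<^esub> x"
      using v smult_l_distr[of r t v] by (simp add: W)
    show "(r \<otimes>\<^bsub>real_ring\<^esub> t) \<odot>\<^bsub>E'\<^esub> x = r \<odot>\<^bsub>E'\<^esub> (t \<odot>\<^bsub>E'\<^esub> x)"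
      using v smult_assoc1[of r t v] by (simp add: W)
    show "\<one>\<^bsub>real_ring\<^esub> \<odot>\<^bsub>E'\<^esub> x = x"
      using v smult_one[of v] by (simp add: W)
    assume "y \<in> carrier E'"
    then obtain w where w: "w \<in> W" "y = f w" by auto
    show "r \<odot>\<^bsub>E'\<^esub> (x \<oplus>\<^bsub>E'\<^esub> y) = r \<odot>\<^bsub>E'\<^esub> x \<oplus>\<^bsub>E'\<^esub> r \<odot>\<^bsub>E'\<^esub> y"
      using v w smult_r_distr[of r v w] by (simp add: W)
  qed
  have minus': "f u \<ominus>\<^bsub>E'\<^esub> f v = f (u \<ominus> v)" if "u \<in> W" "v \<in> W" for u v
  proof -
    have "f u \<ominus>\<^bsub>E'\<^esub> f v = f u \<oplus>\<^bsub>E'\<^esub> (- 1) \<odot>\<^bsub>E'\<^esub> f v"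
      using that E'.smult_l_minus[of 1 "f v"] E'.smult_one[of "f v"] by (simp add: a_minus_def)
    then show ?thesis using that by (simp add: minus_eq_smult W)
  qed
  have W_minus: "u \<ominus> v \<in> W" if "u \<in> W" "v \<in> W" for u v
    using that by (simp add: minus_eq_smult W)
  have norm': "hnorm E' (f v) = hnorm E v" if "v \<in> W" for v
    using that by (simp add: hnorm_def)
  show ?thesis
  proof (unfold_locales, goal_cases)
    case (5 \<sigma>)
    define \<tau> where "\<tau> n = inv_into W f (\<sigma> n)" for n
    have \<tau>: "\<tau> n \<in> W" and \<sigma>: "\<sigma> n = f (\<tau> n)" for n
      using 5(1)[of n] by (auto simp: \<tau>_def)
    have "\<exists>l\<in>carrier E. (\<lambda>n. hnorm E (\<tau> n \<ominus> l)) \<longlonglongrightarrow> 0"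
      using 5(2) by (intro complete) (auto simp: \<sigma> minus' norm' W_minus \<tau> W)
    then obtain l where l: "l \<in> carrier E" "(\<lambda>n. hnorm E (\<tau> n \<ominus> l)) \<longlonglongrightarrow> 0" by blast
    have "hinner E w l = 0" if w: "w \<in> carrier E" "\<forall>x\<in>B. hinner E w x = 0" for w
    proof -
      have le: "\<bar>hinner E w l\<bar> \<le> hnorm E w * hnorm E (\<tau> n \<ominus> l)" for n
      proof -
        have "hinner E w (\<tau> n \<ominus> l) = - hinner E w l"
          using w l \<tau>[of n] by (simp add: hinner_minus_right W_def)
        then show ?thesis
          using Cauchy_Schwarz[of w "\<tau> n \<ominus> l"] w l W[OF \<tau>[of n]] by simp
      qed
      have "(\<lambda>n. hnorm E w * hnorm E (\<tau> n \<ominus> l)) \<longlonglongrightarrow> hnorm E w * 0"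
        by (intro tendsto_intros l)
      then have "\<bar>hinner E w l\<bar> \<le> hnorm E w * 0"
        by (rule LIMSEQ_le_const) (use le in auto)
      then show ?thesis by simp
    qed
    then have "l \<in> W" using l by (auto simp: W_def)
    then show ?case
      using l by (auto intro!: bexI[of _ "f l"] simp: \<sigma> minus' norm' W_minus \<tau>)
  next
    case (4 x)
    then obtain v where v: "v \<in> W" "x = f v" by auto
    then have "v \<noteq> \<zero>" using 4 by auto
    then show ?case using v hinner_pos[of v] by (simp add: W)
  next
    case (1 x y)
    then obtain u v where "u \<in> W" "x = f u" "v \<in> W" "y = f v" by auto
    then show ?case using hinner_commute[of u v] by (simp add: W)
  qed (auto simp: W hinner_add_left hinner_smult_left)
qed

end

theorem a_T_menableI:
  fixes G :: "('g, 'n) monoid_scheme" and E :: "('e, 'm) hilbert_scheme"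
  assumes G: "group G" and hilbert: "real_hilbert E"
    and act: "affine_isometric_action G E \<pi> b" and proper: "metrically_proper G S E \<pi> b"
  shows "a_T_menable G S"
proof -
  interpret group G by (rule G)
  interpret E: real_hilbert E by (rule hilbert)
  note d = act[unfolded affine_isometric_action_def linear_surjective_isometry_def]
  have \<pi>_closed [simp]: "\<pi> g v \<in> carrier E" if "g \<in> carrier G" "v \<in> carrier E" for g v
    using d that by blast
  have \<pi>_add: "\<pi> g (u \<oplus>\<^bsub>E\<^esub> v) = \<pi> g u \<oplus>\<^bsub>E\<^esub> \<pi> g v"
    if "g \<in> carrier G" "u \<in> carrier E" "v \<in> carrier E" for g u v
    using d that by blast
  have \<pi>_smult: "\<pi> g (c \<odot>\<^bsub>E\<^esub> v) = c \<odot>\<^bsub>E\<^esub> \<pi> g v" if "g \<in> carrier G" "v \<in> carrier E" for g c v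
    using d that by blast
  have \<pi>_norm: "hnorm E (\<pi> g v) = hnorm E v" if "g \<in> carrier G" "v \<in> carrier E" for g v
    using d that by blast
  have \<pi>_one: "\<pi> \<one>\<^bsub>G\<^esub> v = v" if "v \<in> carrier E" for v using d that by blast
  have \<pi>_mult: "\<pi> (g \<otimes>\<^bsub>G\<^esub> h) v = \<pi> g (\<pi> h v)"
    if "g \<in> carrier G" "h \<in> carrier G" "v \<in> carrier E" for g h v
    using d that by blast
  have b_closed [simp]: "b g \<in> carrier E" if "g \<in> carrier G" for g using d that by blast
  have b_mult: "b (g \<otimes>\<^bsub>G\<^esub> h) = \<pi> g (b h) \<oplus>\<^bsub>E\<^esub> b g"
    if "g \<in> carrier G" "h \<in> carrier G" for g h
    using d that by blast
  have sq: "hinner E (\<pi> g v) (\<pi> g v) = hinner E v v" if "g \<in> carrier G" "v \<in> carrier E" for g v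
    using \<pi>_norm[OF that] that by (metis E.hnorm_power2 \<pi>_closed)
  have \<pi>_inner: "hinner E (\<pi> g u) (\<pi> g v) = hinner E u v"
    if "g \<in> carrier G" "u \<in> carrier E" "v \<in> carrier E" for g u v
    using sq[of g "u \<oplus>\<^bsub>E\<^esub> v"] sq[of g u] sq[of g v] that
      E.hinner_commute[of u v] E.hinner_commute[of "\<pi> g u" "\<pi> g v"]
    by (simp add: \<pi>_add E.hinner_add_left E.hinner_add_right)
  define B where "B = b ` carrier G"
  define W where "W = {v \<in> carrier E. \<forall>w\<in>carrier E. (\<forall>x\<in>B. hinner E w x = 0) \<longrightarrow> hinner E w v = 0}"
  define f where "f v = (\<lambda>g. if g \<in> carrier G then hinner E v (b g) else 0)" for v
  have W: "v \<in> carrier E" if "v \<in> W" for v using that by (simp add: W_def)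
  have W_add [simp]: "u \<oplus>\<^bsub>E\<^esub> v \<in> W" if "u \<in> W" "v \<in> W" for u v
    using that by (auto simp: W_def E.hinner_add_right)
  have W_smult [simp]: "c \<odot>\<^bsub>E\<^esub> v \<in> W" if "v \<in> W" for c v
    using that by (auto simp: W_def E.hinner_smult_right)
  have W_b [simp]: "b g \<in> W" if "g \<in> carrier G" for g
    using that by (auto simp: W_def B_def)
  have inj: "inj_on f W"
  proof (rule inj_onI)
    fix u v assume uv: "u \<in> W" "v \<in> W" "f u = f v"
    define w where "w = u \<oplus>\<^bsub>E\<^esub> (- 1) \<odot>\<^bsub>E\<^esub> v"
    have wW: "w \<in> W" using uv by (simp add: w_def)
    have "hinner E u (b g) = hinner E v (b g)" if "g \<in> carrier G" for g
      using fun_cong[OF uv(3), of g] that by (simp add: f_def)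
    then have "\<forall>x\<in>B. hinner E w x = 0"
      using uv by (auto simp: B_def w_def E.hinner_add_left E.hinner_smult_left W)
    then have "hinner E w w = 0" using wW by (auto simp: W_def)
    then have "w = \<zero>\<^bsub>E\<^esub>" using E.hinner_pos[of w] W[OF wW] by force
    then have "u \<ominus>\<^bsub>E\<^esub> v = \<zero>\<^bsub>E\<^esub>" using uv by (simp add: w_def E.minus_eq_smult W)
    moreover have "(u \<ominus>\<^bsub>E\<^esub> v) \<oplus>\<^bsub>E\<^esub> v = u"
      using uv by (simp add: a_minus_def E.M.a_assoc E.M.l_neg W)
    ultimately show "u = v" using uv W by simp
  qed
  have W_\<pi> [simp]: "\<pi> g v \<in> W" if g: "g \<in> carrier G" and v: "v \<in> W" for g v
  proof -
    have "hinner E w (\<pi> g v) = 0" if w: "w \<in> carrier E" "\<forall>x\<in>B. hinner E w x = 0" for w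
    proof -
      define k where "k = inv\<^bsub>G\<^esub> g"
      have k [simp]: "k \<in> carrier G" using g by (simp add: k_def)
      have gk: "\<pi> g (\<pi> k u) = u" if "u \<in> carrier E" for u
        using that g \<pi>_mult[of g k u] by (simp add: k_def \<pi>_one)
      have "hinner E (\<pi> k w) (b h) = 0" if h: "h \<in> carrier G" for h
      proof -
        have "hinner E (\<pi> k w) (b h) = hinner E w (\<pi> g (b h))"
          using \<pi>_inner[of g "\<pi> k w" "b h"] g h w by (simp add: gk)
        moreover have "hinner E w (b (g \<otimes>\<^bsub>G\<^esub> h)) = hinner E w (\<pi> g (b h)) + hinner E w (b g)"
          using g h w by (simp add: b_mult E.hinner_add_right)
        ultimately show ?thesis using w g h by (auto simp: B_def)
      qed
      then have "hinner E (\<pi> k w) v = 0" using v w by (auto simp: W_def B_def)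
      then show ?thesis
        using \<pi>_inner[of g "\<pi> k w" v] g v w by (simp add: gk W)
    qed
    then show ?thesis using g v by (auto simp: W_def)
  qed
  define j where "j = inv_into W f"
  have j [simp]: "j (f v) = v" if "v \<in> W" for v
    using inj that by (simp add: j_def)
  define E' :: "('g \<Rightarrow> real) hilbert" where "E' = \<lparr>carrier = f ` W, mult = undefined, one = undefined, zero = f \<zero>\<^bsub>E\<^esub>,
      add = (\<lambda>x y. f (j x \<oplus>\<^bsub>E\<^esub> j y)), smult = (\<lambda>c x. f (c \<odot>\<^bsub>E\<^esub> j x)),
      hinner = (\<lambda>x y. hinner E (j x) (j y))\<rparr>"
  have E': "real_hilbert E'"
    by (rule E.real_hilbert_bicommutant_of_set[OF W_def inj]) (simp add: E'_def j_def)
  have c [simp]: "carrier E' = f ` W" by (simp add: E'_def)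
  have a [simp]: "f u \<oplus>\<^bsub>E'\<^esub> f v = f (u \<oplus>\<^bsub>E\<^esub> v)" if "u \<in> W" "v \<in> W" for u v
    using that by (simp add: E'_def)
  have s [simp]: "k \<odot>\<^bsub>E'\<^esub> f v = f (k \<odot>\<^bsub>E\<^esub> v)" if "v \<in> W" for k v
    using that by (simp add: E'_def)
  have n [simp]: "hnorm E' (f v) = hnorm E v" if "v \<in> W" for v
    using that by (simp add: E'_def hnorm_def)
  define \<pi>' where "\<pi>' g x = f (\<pi> g (j x))" for g x
  define b' where "b' g = f (b g)" for g
  have surj: "\<pi>' g ` (f ` W) = f ` W" if g: "g \<in> carrier G" for g
  proof
    show "\<pi>' g ` (f ` W) \<subseteq> f ` W" using g by (auto simp: \<pi>'_def)
    show "f ` W \<subseteq> \<pi>' g ` (f ` W)"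
    proof
      fix x assume "x \<in> f ` W"
      then obtain v where v: "v \<in> W" "x = f v" by auto
      have "\<pi> g (\<pi> (inv\<^bsub>G\<^esub> g) v) = v"
        using g v \<pi>_mult[of g "inv\<^bsub>G\<^esub> g" v] by (simp add: \<pi>_one W)
      then have "x = \<pi>' g (f (\<pi> (inv\<^bsub>G\<^esub> g) v))" using g v by (simp add: \<pi>'_def)
      then show "x \<in> \<pi>' g ` (f ` W)" using g v by auto
    qed
  qed
  have "affine_isometric_action G E' \<pi>' b'"
    unfolding affine_isometric_action_def linear_surjective_isometry_def
    by (auto simp: surj) (auto simp: \<pi>'_def b'_def \<pi>_add \<pi>_smult \<pi>_norm \<pi>_one \<pi>_mult b_mult W)
  moreover have "metrically_proper G S E' \<pi>' b'"
    unfolding metrically_proper_def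
  proof
    fix x assume "x \<in> carrier E'"
    then obtain v where v: "v \<in> W" "x = f v" by auto
    have lim: "filterlim (\<lambda>g. hnorm E (\<pi> g v \<oplus>\<^bsub>E\<^esub> b g)) at_top (word_length_at_top G S)"
      using proper W[OF v(1)] by (simp add: metrically_proper_def)
    have ev: "eventually (\<lambda>g. hnorm E' (\<pi>' g x \<oplus>\<^bsub>E'\<^esub> b' g) = hnorm E (\<pi> g v \<oplus>\<^bsub>E\<^esub> b g))
        (word_length_at_top G S)"
      unfolding word_length_at_top_def eventually_inf_principal
      by (rule always_eventually) (simp add: v \<pi>'_def b'_def)
    show "filterlim (\<lambda>g. hnorm E' (\<pi>' g x \<oplus>\<^bsub>E'\<^esub> b' g)) at_top (word_length_at_top G S)"
      by (rule iffD2[OF filterlim_cong[OF refl refl ev] lim])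
  qed
  ultimately have "real_hilbert E' \<and> affine_isometric_action G E' \<pi>' b' \<and> metrically_proper G S E' \<pi>' b'"
    by (intro conjI E')
  then show ?thesis unfolding a_T_menable_def by (intro exI)
qed

text \<open>In particular every type in the class of complete real inner product spaces is covered.\<close>

definition type_hilbert :: "'e::{real_inner, complete_space} hilbert"
  where "type_hilbert = \<lparr>carrier = UNIV, mult = undefined, one = undefined, zero = 0, add = (+),
    smult = (*\<^sub>R), hinner = (\<bullet>)\<rparr>"

lemma real_hilbert_type_hilbert:
  "real_hilbert (type_hilbert :: 'e::{real_inner, complete_space} hilbert)" (is "real_hilbert ?E")
proof -
  have [simp]: "carrier ?E = UNIV" "\<zero>\<^bsub>?E\<^esub> = 0" "x \<oplus>\<^bsub>?E\<^esub> y = x + y" "c \<odot>\<^bsub>?E\<^esub> x = c *\<^sub>R x"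
    "hinner ?E x y = x \<bullet> y" for x y :: 'e and c
    by (simp_all add: type_hilbert_def)
  have ab: "abelian_group ?E"
  proof (rule abelian_groupI)
    show "\<exists>y\<in>carrier ?E. y \<oplus>\<^bsub>?E\<^esub> x = \<zero>\<^bsub>?E\<^esub>" for x
      by (auto intro: exI[of _ "- x"])
  qed (auto simp: algebra_simps)
  interpret E: module real_ring ?E
    by (rule moduleI) (auto simp: cring_real_ring ab algebra_simps)
  have [simp]: "x \<ominus>\<^bsub>?E\<^esub> y = x - y" for x y
    using E.minus_equality[of "- y" y] by (simp add: a_minus_def)
  have [simp]: "hnorm ?E x = norm x" for x
    by (simp add: hnorm_def norm_eq_sqrt_inner)
  show ?thesis
  proof (unfold_locales, goal_cases)
    case (5 \<sigma>)
    then have "Cauchy \<sigma>" by (auto simp: Cauchy_def dist_norm)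
    then obtain l where "\<sigma> \<longlonglongrightarrow> l" using Cauchy_convergent_iff convergent_def by blast
    then have "(\<lambda>n. norm (\<sigma> n - l)) \<longlonglongrightarrow> 0"
      by (simp add: LIM_zero tendsto_norm_zero)
    then show ?case by auto
  qed (auto simp: inner_commute inner_add_left inner_add_right)
qed

section \<open>Translates of measures and topological amenability\<close>

definition translate_measure ::
    "('g, 'n) monoid_scheme \<Rightarrow> ('g \<Rightarrow> 'x \<Rightarrow> 'x) \<Rightarrow> 'g \<Rightarrow> 'x measure \<Rightarrow> 'x measure"
  where "translate_measure G \<Phi> g \<nu> =
    measure_of (space \<nu>) (sets \<nu>) (\<lambda>A. emeasure \<nu> (\<Phi> (inv\<^bsub>G\<^esub> g) ` A))"

definition measure_class_preserved ::
    "('g, 'n) monoid_scheme \<Rightarrow> ('g \<Rightarrow> 'x \<Rightarrow> 'x) \<Rightarrow> 'x measure \<Rightarrow> bool"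
  where "measure_class_preserved G \<Phi> \<nu> \<longleftrightarrow>
    (\<forall>g\<in>carrier G. absolutely_continuous \<nu> (translate_measure G \<Phi> g \<nu>) \<and>
      absolutely_continuous (translate_measure G \<Phi> g \<nu>) \<nu>)"

text \<open>Since \<open>\<Phi>\<close> is an action, the translate is the push-forward under \<open>\<Phi> g\<close>.\<close>

lemma translate_measure_eq_distr:
  assumes act: "group_action G (space \<nu>) \<Phi>" and g: "g \<in> carrier G"
    and meas: "\<Phi> g \<in> measurable \<nu> \<nu>"
  shows "translate_measure G \<Phi> g \<nu> = distr \<nu> \<nu> (\<Phi> g)"
proof -
  interpret group_action G "space \<nu>" \<Phi> by (rule act)
  interpret group G using group_hom group_hom.axioms(1) by blast
  have gi: "inv\<^bsub>G\<^esub> g \<in> carrier G" using g by simp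
  have eq: "\<Phi> (inv\<^bsub>G\<^esub> g) ` A = \<Phi> g -` A \<inter> space \<nu>" if A: "A \<subseteq> space \<nu>" for A
  proof (intro equalityI subsetI)
    fix y assume "y \<in> \<Phi> (inv\<^bsub>G\<^esub> g) ` A"
    then obtain x where x: "x \<in> A" "y = \<Phi> (inv\<^bsub>G\<^esub> g) x" by auto
    have y: "y \<in> space \<nu>" using x A gi element_image by blast
    then have "\<Phi> g y = x" using orbit_sym_aux[OF gi] x A g by auto
    then show "y \<in> \<Phi> g -` A \<inter> space \<nu>" using x y by auto
  next
    fix y assume y: "y \<in> \<Phi> g -` A \<inter> space \<nu>"
    then have "\<Phi> (inv\<^bsub>G\<^esub> g) (\<Phi> g y) = y" using orbit_sym_aux[OF g] by blast
    then show "y \<in> \<Phi> (inv\<^bsub>G\<^esub> g) ` A" using y by (metis IntD1 image_eqI vimageD)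
  qed
  show ?thesis
    unfolding translate_measure_def distr_def
    by (rule measure_of_eq) (auto simp: sets.space_closed sets.sigma_sets_eq eq[OF sets.sets_into_space])
qed

text \<open>The space \<open>\<FF>\<close> of finitely supported functions from \<open>G\<close> to \<open>C(X)\<close>, with \<open>X\<close> the whole type.\<close>

definition finsupp_C ::
    "('g, 'n) monoid_scheme \<Rightarrow> ('g \<Rightarrow> 'x::topological_space \<Rightarrow> real) set"
  where "finsupp_C G = {\<xi>. (\<forall>g\<in>carrier G. continuous_on UNIV (\<xi> g)) \<and>
    finite {g \<in> carrier G. \<xi> g \<noteq> (\<lambda>x. 0)}}"

text \<open>
  The sum is restricted to the support of the first argument because sums over infinite sets are
  zero by convention; the omitted terms vanish.
\<close>

definition inner_C ::
    "('g, 'n) monoid_scheme \<Rightarrow> ('g \<Rightarrow> 'x \<Rightarrow> real) \<Rightarrow> ('g \<Rightarrow> 'x \<Rightarrow> real) \<Rightarrow> 'x \<Rightarrow> real"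
  where "inner_C G \<xi> \<eta> x = (\<Sum>g\<in>{g \<in> carrier G. \<xi> g \<noteq> (\<lambda>x. 0)}. \<xi> g x * \<eta> g x)"

definition left_translate ::
    "('g, 'n) monoid_scheme \<Rightarrow> ('g \<Rightarrow> 'x \<Rightarrow> 'x) \<Rightarrow> 'g \<Rightarrow> ('g \<Rightarrow> 'x \<Rightarrow> real) \<Rightarrow> 'g \<Rightarrow> 'x \<Rightarrow> real"
  where "left_translate G \<Phi> g \<xi> h x = \<xi> (inv\<^bsub>G\<^esub> g \<otimes>\<^bsub>G\<^esub> h) (\<Phi> (inv\<^bsub>G\<^esub> g) x)"

definition topologically_amenable ::
    "('g, 'n) monoid_scheme \<Rightarrow> 'g set \<Rightarrow> ('g \<Rightarrow> 'x::topological_space \<Rightarrow> 'x) \<Rightarrow> bool"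
  where "topologically_amenable G S \<Phi> \<longleftrightarrow>
    (\<forall>\<epsilon>>0. \<exists>\<xi>\<in>finsupp_C G.
      (\<forall>g\<in>carrier G. \<forall>x. \<xi> g x \<ge> 0) \<and>
      (\<forall>x. inner_C G \<xi> \<xi> x = 1) \<and>
      (SUP x. 1 - 1 / real (card S) * (\<Sum>s\<in>S. inner_C G \<xi> (left_translate G \<Phi> s \<xi>) x)) \<le> \<epsilon>)"

end

theory Submission
  imports Defs
begin

text \<open>
  The supremum \<open>w\<close> of the derivatives, and likewise the infimum, satisfies
  \<open>w(x) = \<rho>\<^sub>g(x) w(g\<^sup>-\<^sup>1x)\<close> by the cocycle identity, so that \<open>w\<nu>\<close> is an invariant measure. The
  integrability conditions make it finite and nonzero; let \<open>\<mu>\<close> be its normalisation. For \<open>\<xi>\<close>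
  as in the definition of topological amenability, \<open>\<eta>(h) = \<parallel>\<xi>\<^sub>h\<parallel>\<close> in \<open>L\<^sub>2(\<mu>)\<close> is a finitely
  supported unit vector of \<open>\<ell>\<^sub>2(G)\<close> that is moved little by the generators, by the
  Cauchy-Schwarz inequality (so \<open>G\<close> is amenable). A sequence of such vectors \<open>\<eta>\<^sub>n\<close>, moved by less
  and less, gives the formal coboundary \<open>b\<^sub>g = (\<eta>\<^sub>n - g\<eta>\<^sub>n)\<^sub>n\<close>, a proper cocycle in
  \<open>\<ell>\<^sub>2(\<nat> \<times> G)\<close>: once \<open>g\<close> moves the supports of \<open>\<eta>\<^sub>0, \<dots>, \<eta>\<^sub>N\<^sub>-\<^sub>1\<close> off themselves,
  \<open>\<parallel>b\<^sub>g\<parallel>\<^sup>2 \<ge> N\<close>.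
\<close>

section \<open>The Hilbert space of square summable functions\<close>

text \<open>Unordered sums admit any index type and are unchanged by a permutation of the indices,
  so permutations act by isometries. The index type used later is
  \<open>nat \<times> 'g\<close>.\<close>

definition ell2 :: "('i \<Rightarrow> real) hilbert" where
  "ell2 = \<lparr>carrier = {f. (\<lambda>i. (f i)\<^sup>2) summable_on UNIV}, mult = undefined, one = undefined,
    zero = (\<lambda>i. 0), add = (\<lambda>f g i. f i + g i), smult = (\<lambda>c f i. c * f i),
    hinner = (\<lambda>f g. \<Sum>\<^sub>\<infinity>i. f i * g i)\<rparr>"

lemma ell2_simps [simp]:
  "f \<in> carrier ell2 \<longleftrightarrow> (\<lambda>i. (f i)\<^sup>2) summable_on UNIV"
  "\<zero>\<^bsub>ell2\<^esub> = (\<lambda>i. 0)" "f \<oplus>\<^bsub>ell2\<^esub> g = (\<lambda>i. f i + g i)" "c \<odot>\<^bsub>ell2\<^esub> f = (\<lambda>i. c * f i)"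
  "hinner ell2 f g = (\<Sum>\<^sub>\<infinity>i. f i * g i)"
  by (simp_all add: ell2_def)

lemma hnorm_ell2: "hnorm ell2 f = sqrt (\<Sum>\<^sub>\<infinity>i. (f i)\<^sup>2)"
  by (simp add: hnorm_def power2_eq_square)

text \<open>Comparison with \<open>(f i)\<^sup>2 + (g i)\<^sup>2\<close>, which is at least
  \<open>2 * \<bar>f i * g i\<bar>\<close>.\<close>

lemma summable_on_mult_squares:
  fixes f g :: "'i \<Rightarrow> real"
  assumes "(\<lambda>i. (f i)\<^sup>2) summable_on A" "(\<lambda>i. (g i)\<^sup>2) summable_on A"
  shows "(\<lambda>i. f i * g i) summable_on A"
proof -
  have bound: "norm (f i * g i) \<le> (f i)\<^sup>2 + (g i)\<^sup>2" for i
    using sum_squares_bound[of "\<bar>f i\<bar>" "\<bar>g i\<bar>"] abs_ge_zero[of "f i * g i"]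
    unfolding real_norm_def abs_mult power2_abs by linarith
  have "(\<lambda>i. norm (f i * g i)) summable_on A"
    by (rule summable_on_comparison_test[OF summable_on_add[OF assms]]) (rule bound norm_ge_zero)+
  then show ?thesis by (rule iffD2[OF summable_on_iff_abs_summable_on_real])
qed

lemma summable_on_square_add:
  fixes f g :: "'i \<Rightarrow> real"
  assumes "(\<lambda>i. (f i)\<^sup>2) summable_on A" "(\<lambda>i. (g i)\<^sup>2) summable_on A"
  shows "(\<lambda>i. (f i + g i)\<^sup>2) summable_on A"
proof -
  have "(\<lambda>i. (f i)\<^sup>2 + (g i)\<^sup>2 + 2 * (f i * g i)) summable_on A"
    by (intro summable_on_add summable_on_cmult_right summable_on_mult_squares assms)
  then show ?thesis by (simp add: power2_sum algebra_simps)
qed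

lemma module_ell2: "module real_ring (ell2 :: ('i \<Rightarrow> real) hilbert)"
proof (rule moduleI)
  show "abelian_group (ell2 :: ('i \<Rightarrow> real) hilbert)"
  proof (rule abelian_groupI)
    fix f :: "'i \<Rightarrow> real" assume "f \<in> carrier ell2"
    then show "\<exists>g\<in>carrier ell2. g \<oplus>\<^bsub>ell2\<^esub> f = \<zero>\<^bsub>ell2\<^esub>"
      by (intro bexI[of _ "\<lambda>i. - f i"]) auto
  qed (auto simp: summable_on_square_add algebra_simps)
qed (auto simp: cring_real_ring algebra_simps power_mult_distrib intro: summable_on_cmult_right)

lemma minus_ell2:
  assumes "g \<in> carrier ell2" shows "f \<ominus>\<^bsub>ell2\<^esub> g = (\<lambda>i. f i - g i)"
proof -
  interpret module real_ring ell2 by (rule module_ell2)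
  have "\<ominus>\<^bsub>ell2\<^esub> g = (\<lambda>i. - g i)"
    using assms by (intro M.minus_equality) auto
  then show ?thesis by (simp add: a_minus_def)
qed

text \<open>For completeness: a Cauchy sequence converges in every coordinate. Bounds on finite
  partial sums of the differences survive the limit, and being uniform in the finite set they bound
  the full sum.\<close>

lemma real_hilbert_ell2: "real_hilbert (ell2 :: ('i \<Rightarrow> real) hilbert)"
proof -
  interpret module real_ring "ell2 :: ('i \<Rightarrow> real) hilbert" by (rule module_ell2)
  show ?thesis
  proof (unfold_locales, goal_cases)
    case (1 f g)
    show ?case by (simp add: mult.commute)
  next
    case (2 f g h)
    then show ?case by (simp add: algebra_simps infsum_add summable_on_mult_squares)
  next
    case (3 f g c)
    then show ?case by (simp add: mult.assoc infsum_cmult_right summable_on_mult_squares)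
  next
    case (4 f)
    then obtain i where i: "f i \<noteq> 0" by auto
    have "(\<Sum>j\<in>{i}. (f j)\<^sup>2) \<le> (\<Sum>\<^sub>\<infinity>j. (f j)\<^sup>2)"
      using 4 by (intro finite_sum_le_infsum) auto
    moreover have "(f i)\<^sup>2 > 0" using i by simp
    ultimately show ?case by (simp add: power2_eq_square)
  next
    case (5 \<sigma>)
    have sq: "(\<lambda>i. (\<sigma> n i)\<^sup>2) summable_on UNIV" for n using 5(1)[of n] by simp
    have diff: "(\<lambda>i. (f i - g i)\<^sup>2) summable_on UNIV"
      if "(\<lambda>i. (f i)\<^sup>2) summable_on UNIV" "(\<lambda>i. (g i)\<^sup>2) summable_on UNIV" for f g :: "'i \<Rightarrow> real"
      using summable_on_square_add[of f UNIV "\<lambda>i. - g i"] that by simp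
    have fin: "(\<Sum>i\<in>F. (\<sigma> m i - \<sigma> n i)\<^sup>2) \<le> (hnorm ell2 (\<sigma> m \<ominus>\<^bsub>ell2\<^esub> \<sigma> n))\<^sup>2" if "finite F" for F m n
      unfolding minus_ell2[OF 5(1)] hnorm_ell2 using that
      by (simp add: infsum_nonneg) (intro finite_sum_le_infsum diff sq; simp)
    have coord: "\<bar>\<sigma> m i - \<sigma> n i\<bar> \<le> hnorm ell2 (\<sigma> m \<ominus>\<^bsub>ell2\<^esub> \<sigma> n)" for i m n
    proof (rule power2_le_imp_le)
      show "\<bar>\<sigma> m i - \<sigma> n i\<bar>\<^sup>2 \<le> (hnorm ell2 (\<sigma> m \<ominus>\<^bsub>ell2\<^esub> \<sigma> n))\<^sup>2"
        using fin[of "{i}" m n] by simp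
    qed (simp add: hnorm_ell2 infsum_nonneg)
    have "Cauchy (\<lambda>n. \<sigma> n i)" for i
      unfolding Cauchy_def dist_real_def
    proof (intro allI impI)
      fix e :: real assume "e > 0"
      then obtain N where "\<forall>m\<ge>N. \<forall>n\<ge>N. hnorm ell2 (\<sigma> m \<ominus>\<^bsub>ell2\<^esub> \<sigma> n) < e" using 5(2) by blast
      then show "\<exists>N. \<forall>m\<ge>N. \<forall>n\<ge>N. \<bar>\<sigma> m i - \<sigma> n i\<bar> < e"
        by (intro exI[of _ N] allI impI le_less_trans[OF coord]) auto
    qed
    then have "\<exists>l. (\<lambda>n. \<sigma> n i) \<longlonglongrightarrow> l" for i
      using Cauchy_convergent_iff convergent_def by blast
    then obtain l where l: "\<And>i. (\<lambda>n. \<sigma> n i) \<longlonglongrightarrow> l i" by metis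
    \<comment> \<open>Here \<open>m\<close> is fixed and \<open>n\<close> tends to infinity. The
      bound does not depend on \<open>F\<close>, so it gives both the summability of
      \<open>(\<sigma> m i - l i)\<^sup>2\<close> and the estimate of the norm.\<close>
    have tail: "(\<Sum>i\<in>F. (\<sigma> m i - l i)\<^sup>2) \<le> e\<^sup>2"
      if "finite F" and N: "\<And>n. n \<ge> N \<Longrightarrow> hnorm ell2 (\<sigma> m \<ominus>\<^bsub>ell2\<^esub> \<sigma> n) < e" for F m N e
    proof (rule LIMSEQ_le_const2)
      show "(\<lambda>n. \<Sum>i\<in>F. (\<sigma> m i - \<sigma> n i)\<^sup>2) \<longlonglongrightarrow> (\<Sum>i\<in>F. (\<sigma> m i - l i)\<^sup>2)"
        by (intro tendsto_intros l)
      have "(\<Sum>i\<in>F. (\<sigma> m i - \<sigma> n i)\<^sup>2) \<le> e\<^sup>2" if "n \<ge> N" for n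
      proof -
        have "(hnorm ell2 (\<sigma> m \<ominus>\<^bsub>ell2\<^esub> \<sigma> n))\<^sup>2 \<le> e\<^sup>2"
          using N[OF that] by (intro power_mono) (auto simp: hnorm_ell2 infsum_nonneg)
        then show ?thesis using fin[OF \<open>finite F\<close>, of m n] by linarith
      qed
      then show "\<exists>N. \<forall>n\<ge>N. (\<Sum>i\<in>F. (\<sigma> m i - \<sigma> n i)\<^sup>2) \<le> e\<^sup>2" by blast
    qed
    have summ: "(\<lambda>i. (\<sigma> m i - l i)\<^sup>2) summable_on UNIV"
      if N: "\<And>n. n \<ge> N \<Longrightarrow> hnorm ell2 (\<sigma> m \<ominus>\<^bsub>ell2\<^esub> \<sigma> n) < e" for m N e
      by (rule nonneg_bdd_above_summable_on) (auto intro!: bdd_aboveI[of _ "e\<^sup>2"] tail[OF _ N])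
    obtain N1 where N1: "\<And>m n. m \<ge> N1 \<Longrightarrow> n \<ge> N1 \<Longrightarrow> hnorm ell2 (\<sigma> m \<ominus>\<^bsub>ell2\<^esub> \<sigma> n) < 1"
      using 5(2)[of 1] by auto
    \<comment> \<open>\<open>l\<close> is the difference of \<open>\<sigma> N1\<close> and
      \<open>\<sigma> N1 - l\<close>, both square summable.\<close>
    have lsq: "(\<lambda>i. (l i)\<^sup>2) summable_on UNIV"
      using diff[OF sq[of N1] summ[OF N1[of N1]]] by simp
    have "(\<lambda>n. hnorm ell2 (\<sigma> n \<ominus>\<^bsub>ell2\<^esub> l)) \<longlonglongrightarrow> 0"
    proof (rule LIMSEQ_I)
      fix r :: real assume "r > 0"
      \<comment> \<open>Half of \<open>r\<close>, because limits preserve only weak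
        inequalities.\<close>
      then obtain N where N: "\<And>m n. m \<ge> N \<Longrightarrow> n \<ge> N \<Longrightarrow> hnorm ell2 (\<sigma> m \<ominus>\<^bsub>ell2\<^esub> \<sigma> n) < r / 2"
        using 5(2)[of "r / 2"] by auto
      have "hnorm ell2 (\<sigma> m \<ominus>\<^bsub>ell2\<^esub> l) \<le> r / 2" if "m \<ge> N" for m
      proof -
        have "(\<Sum>\<^sub>\<infinity>i. (\<sigma> m i - l i)\<^sup>2) \<le> (r / 2)\<^sup>2"
          by (intro infsum_le_finite_sums summ[OF N[OF that]] tail[OF _ N[OF that]])
        then have "sqrt (\<Sum>\<^sub>\<infinity>i. (\<sigma> m i - l i)\<^sup>2) \<le> sqrt ((r / 2)\<^sup>2)"
          by (rule real_sqrt_le_mono)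
        then show ?thesis
          unfolding hnorm_ell2 using \<open>r > 0\<close> lsq by (simp only: minus_ell2 ell2_simps) simp
      qed
      moreover have "hnorm ell2 (\<sigma> m \<ominus>\<^bsub>ell2\<^esub> l) \<ge> 0" for m
        by (simp add: hnorm_ell2 infsum_nonneg)
      ultimately have "norm (hnorm ell2 (\<sigma> m \<ominus>\<^bsub>ell2\<^esub> l) - 0) < r" if "m \<ge> N" for m
        using that \<open>r > 0\<close> by (smt (verit) field_sum_of_halves real_norm_def)
      then show "\<exists>N. \<forall>n\<ge>N. norm (hnorm ell2 (\<sigma> n \<ominus>\<^bsub>ell2\<^esub> l) - 0) < r" by blast
    qed
    then show ?case using lsq by (intro bexI[of _ l]) auto
  qed
qed

section \<open>A proper cocycle from almost invariant vectors\<close>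

text \<open>The hypothesis on \<open>\<eta>\<close> is amenability in the form of almost invariant
  unit vectors: each summand over \<open>S\<close> is half the squared displacement of
  \<open>\<eta>\<close> by \<open>s\<close>. This is thus the classical fact that amenable groups
  have the Haagerup property.\<close>

lemma a_T_menable_if_almost_invariant_vectors:
  fixes G :: "('g, 'n) monoid_scheme" (structure)
  assumes G: "group G" and S: "S \<subseteq> carrier G" "generate G S = carrier G" "finite S"
    and almost_invariant: "\<And>\<epsilon>::real. \<epsilon> > 0 \<Longrightarrow> \<exists>\<eta> :: 'g \<Rightarrow> real.
      finite {h. \<eta> h \<noteq> 0} \<and> {h. \<eta> h \<noteq> 0} \<subseteq> carrier G \<and> (\<Sum>h | \<eta> h \<noteq> 0. (\<eta> h)\<^sup>2) = 1 \<and>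
      (\<Sum>s\<in>S. 1 - (\<Sum>h | \<eta> h \<noteq> 0. \<eta> h * \<eta> (inv\<^bsub>G\<^esub> s \<otimes>\<^bsub>G\<^esub> h))) \<le> \<epsilon>"
  shows "a_T_menable G S"
proof -
  interpret group G by (rule G)
  define ai where "ai \<epsilon> \<eta> \<longleftrightarrow> finite {h. \<eta> h \<noteq> 0} \<and> {h. \<eta> h \<noteq> 0} \<subseteq> carrier G \<and>
    (\<Sum>h | \<eta> h \<noteq> 0. (\<eta> h)\<^sup>2) = 1 \<and>
    (\<Sum>s\<in>S. 1 - (\<Sum>h | \<eta> h \<noteq> 0. \<eta> h * \<eta> (inv s \<otimes> h))) \<le> \<epsilon>" for \<epsilon> and \<eta> :: "'g \<Rightarrow> real"
  \<comment> \<open>The tolerances have to be summable in \<open>n\<close>, since they will bound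
    the layers of \<open>b s\<close>, whose squared norms are summed over all
    \<open>n\<close>.\<close>
  have "\<exists>\<eta>. ai ((1 / 2) ^ n) \<eta>" for n :: nat
    unfolding ai_def by (rule almost_invariant) simp
  then obtain \<eta> where "\<And>n. ai ((1 / 2) ^ n) (\<eta> n)" by metis
  then have fin: "finite {h. \<eta> n h \<noteq> 0}" and sub: "{h. \<eta> n h \<noteq> 0} \<subseteq> carrier G"
    and unit: "(\<Sum>h | \<eta> n h \<noteq> 0. (\<eta> n h)\<^sup>2) = 1"
    and close: "(\<Sum>s\<in>S. 1 - (\<Sum>h | \<eta> n h \<noteq> 0. \<eta> n h * \<eta> n (inv s \<otimes> h))) \<le> (1 / 2) ^ n" for n
    unfolding ai_def by blast+
  define K where "K n = {h. \<eta> n h \<noteq> 0}" for n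
  have K: "finite (K n)" "K n \<subseteq> carrier G" for n using fin sub by (auto simp: K_def)
  \<comment> \<open>extended by the identity to a permutation of the type, so that \<open>ell2\<close> needs no carrier set for indices\<close>
  define \<tau> where "\<tau> g h = (if h \<in> carrier G then inv g \<otimes> h else h)" for g h
  \<comment> \<open>\<open>\<tau>\<close> reverses products, so precomposition with it, as in
    \<open>\<pi>\<close> below, preserves them.\<close>
  have \<tau>_mult: "\<tau> h (\<tau> g k) = \<tau> (g \<otimes> h) k" if "g \<in> carrier G" "h \<in> carrier G" for g h k
    using that by (simp add: \<tau>_def inv_mult_group m_assoc)
  have \<tau>_one: "\<tau> \<one> k = k" for k by (simp add: \<tau>_def)
  have \<tau>_inv: "\<tau> (inv g) (\<tau> g k) = k" "\<tau> g (\<tau> (inv g) k) = k" if "g \<in> carrier G" for g k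
    using that by (simp_all add: \<tau>_mult \<tau>_one)
  have bij_\<tau>: "bij (\<tau> g)" if "g \<in> carrier G" for g
    by (rule o_bij[of "\<tau> (inv g)"]) (use \<tau>_inv that in \<open>auto simp: fun_eq_iff\<close>)
  define shift :: "'g \<Rightarrow> nat \<times> 'g \<Rightarrow> nat \<times> 'g" where "shift g = map_prod id (\<tau> g)" for g
  have shift_mult: "shift h (shift g p) = shift (g \<otimes> h) p" if "g \<in> carrier G" "h \<in> carrier G" for g h p
    using that by (cases p) (simp add: shift_def \<tau>_mult)
  have shift_one: "shift \<one> p = p" for p by (cases p) (simp add: shift_def \<tau>_one)
  have bij_shift: "bij (shift g)" if "g \<in> carrier G" for g
    by (rule o_bij[of "shift (inv g)"]) (use that in \<open>auto simp: fun_eq_iff shift_mult shift_one\<close>)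
  \<comment> \<open>\<open>H\<close> has norm one in every layer \<open>n\<close>, so it is not
    square summable. Hence \<open>b\<close> is a coboundary only formally, which is what allows it
    to be unbounded.\<close>
  define H :: "nat \<times> 'g \<Rightarrow> real" where "H = (\<lambda>(n, h). \<eta> n h)"
  define \<pi> :: "'g \<Rightarrow> (nat \<times> 'g \<Rightarrow> real) \<Rightarrow> nat \<times> 'g \<Rightarrow> real" where "\<pi> g f = (\<lambda>p. f (shift g p))" for g f
  define b where "b g = (\<lambda>p. H p - H (shift g p))" for g
  have b_mult: "b (g \<otimes> h) = (\<lambda>p. \<pi> g (b h) p + b g p)" if "g \<in> carrier G" "h \<in> carrier G" for g h
    using that by (simp add: b_def \<pi>_def shift_mult)
  have \<pi>_summable: "(\<lambda>p. (\<pi> g f p)\<^sup>2) summable_on UNIV \<longleftrightarrow> (\<lambda>p. (f p)\<^sup>2) summable_on UNIV"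
    and \<pi>_norm: "hnorm ell2 (\<pi> g f) = hnorm ell2 f" if "g \<in> carrier G" for g f
    using summable_on_reindex_bij_betw[OF bij_shift[OF that], of "\<lambda>p. (f p)\<^sup>2"]
      infsum_reindex_bij_betw[OF bij_shift[OF that], of "\<lambda>p. (f p)\<^sup>2"]
    by (simp_all add: \<pi>_def hnorm_ell2)

  define D where "D n g = (\<Sum>h\<in>K n. \<eta> n h * \<eta> n (inv g \<otimes> h))" for n g
  \<comment> \<open>Expansion of the square in layer \<open>n\<close>: \<open>\<eta> n\<close> and
    its translate by \<open>g\<close> have norm one, and \<open>D n g\<close> is their inner
    product.\<close>
  have sum_sq: "((\<lambda>h. (b g (n, h))\<^sup>2) has_sum (2 - 2 * D n g)) UNIV" if "g \<in> carrier G" for n g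
  proof -
    have 1: "((\<lambda>h. (\<eta> n h)\<^sup>2) has_sum 1) UNIV"
      by (rule has_sum_finite_neutralI[OF K(1)[of n]]) (use unit[of n] in \<open>auto simp: K_def\<close>)
    moreover have "((\<lambda>h. (\<eta> n (\<tau> g h))\<^sup>2) has_sum 1) UNIV"
      using has_sum_reindex_bij_betw[OF bij_\<tau>[OF that], of "\<lambda>h. (\<eta> n h)\<^sup>2"] 1 by simp
    moreover have "((\<lambda>h. \<eta> n h * \<eta> n (\<tau> g h)) has_sum D n g) UNIV"
      by (rule has_sum_finite_neutralI[OF K(1)[of n]])
        (use K(2)[of n] in \<open>auto simp: D_def \<tau>_def K_def intro!: sum.cong\<close>)
    ultimately have "((\<lambda>h. (\<eta> n h)\<^sup>2 + (\<eta> n (\<tau> g h))\<^sup>2 + (- 2) * (\<eta> n h * \<eta> n (\<tau> g h)))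
        has_sum (1 + 1 + (- 2) * D n g)) UNIV"
      by (intro has_sum_add has_sum_cmult_right)
    then show ?thesis by (simp add: b_def H_def shift_def power2_diff algebra_simps)
  qed
  have D_le: "D n g \<le> 1" if "g \<in> carrier G" for n g
    using has_sum_nonneg[OF sum_sq[OF that, of n]] by simp
  have b_S: "(\<lambda>p. (b s p)\<^sup>2) summable_on UNIV" if s: "s \<in> S" for s
  proof -
    have sG: "s \<in> carrier G" using s S by blast
    have "(\<lambda>n. 2 * (1 / 2 :: real) ^ n) summable_on UNIV"
      by (intro norm_summable_imp_summable_on) (simp add: summable_geometric)
    moreover have "2 - 2 * D n s \<le> 2 * (1 / 2) ^ n" for n
    proof -
      \<comment> \<open>All summands are nonnegative by \<open>D_le\<close>, so the bound on the sum
        over \<open>S\<close> holds for each generator.\<close>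
      have "1 - D n s \<le> (\<Sum>s\<in>S. 1 - D n s)"
        using s S D_le by (intro member_le_sum) auto
      then show ?thesis using close[of n] by (simp add: D_def K_def)
    qed
    ultimately have "(\<lambda>n. 2 - 2 * D n s) summable_on UNIV"
      by (rule summable_on_comparison_test) (use D_le[OF sG] in auto)
    then have "(\<lambda>p. (b s p)\<^sup>2) summable_on (UNIV \<times> UNIV)"
      by (intro summable_on_SigmaI[OF sum_sq[OF sG]]) auto
    then show ?thesis by simp
  qed
  \<comment> \<open>The cocycle identity carries square summability from generators to products, as
    \<open>\<pi> g\<close> is isometric. For inverses, \<open>b \<one> = 0\<close> gives
    \<open>b (inv s) = - \<pi> (inv s) (b s)\<close>.\<close>
  have b_summable: "(\<lambda>p. (b g p)\<^sup>2) summable_on UNIV" if "g \<in> carrier G" for g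
  proof -
    have "g \<in> generate G S" using that S by simp
    then show ?thesis
    proof induction
      case one
      show ?case by (simp add: b_def shift_one)
    next
      case (inv s)
      then have s: "s \<in> carrier G" using S by blast
      have "b (inv s) = (\<lambda>p. - \<pi> (inv s) (b s) p)"
        using s by (simp add: b_def \<pi>_def shift_mult shift_one)
      then show ?case using b_S[OF inv] s by (simp add: \<pi>_summable)
    next
      case (eng g h)
      then have "g \<in> carrier G" "h \<in> carrier G" using S by auto
      then show ?case using eng by (simp add: b_mult summable_on_square_add \<pi>_summable)
    qed (rule b_S)
  qed

  have act: "affine_isometric_action G ell2 \<pi> b"
    unfolding affine_isometric_action_def linear_surjective_isometry_def
  proof (intro conjI ballI allI)
    fix g assume g: "g \<in> carrier G"
    show "\<pi> g ` carrier ell2 = carrier ell2"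
    proof (intro equalityI subsetI)
      fix f :: "nat \<times> 'g \<Rightarrow> real" assume "f \<in> carrier ell2"
      moreover have "f = \<pi> g (\<pi> (inv g) f)"
        using g by (simp add: \<pi>_def shift_mult shift_one)
      ultimately show "f \<in> \<pi> g ` carrier ell2"
        using g by (intro image_eqI[of f "\<pi> g" "\<pi> (inv g) f"]) (simp_all add: \<pi>_summable)
    qed (use g in \<open>auto simp: \<pi>_summable\<close>)
  qed (auto simp: \<pi>_norm b_summable b_mult, auto simp: \<pi>_def shift_one shift_mult)

  \<comment> \<open>The excluded \<open>g\<close> are those for which the translate of some
    \<open>K n\<close> with \<open>n < N\<close> by \<open>g\<close> meets \<open>K n\<close>. For
    any other \<open>g\<close>, \<open>b g\<close> agrees with \<open>H\<close> on these
    \<open>K n\<close>, and each of the \<open>N\<close> layers contributes at least the squared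
    norm of \<open>\<eta> n\<close>, which is one.\<close>
  have norm_b: "real N \<le> (\<Sum>\<^sub>\<infinity>p. (b g p)\<^sup>2)"
    if g: "g \<in> carrier G" "g \<notin> (\<Union>n<N. (\<lambda>(h, k). h \<otimes> inv k) ` (K n \<times> K n))" for N g
  proof -
    have "inv g \<otimes> h \<notin> K n" if h: "n < N" "h \<in> K n" for n h
    proof
      assume k: "inv g \<otimes> h \<in> K n"
      have "g = h \<otimes> inv (inv g \<otimes> h)" using K(2)[of n] h g
        by (simp add: inv_mult_group subset_iff flip: m_assoc)
      with g(2) h k show False by force
    qed
    then have eq: "(b g (n, h))\<^sup>2 = (\<eta> n h)\<^sup>2" if "n < N" "h \<in> K n" for n h
      using that K(2)[of n] by (auto simp: b_def H_def shift_def \<tau>_def K_def)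
    have "(\<Sum>p\<in>Sigma {..<N} K. (b g p)\<^sup>2) = (\<Sum>n<N. \<Sum>h\<in>K n. (b g (n, h))\<^sup>2)"
      using K(1) by (simp add: sum.Sigma split_def)
    also have "\<dots> = (\<Sum>n<N. \<Sum>h\<in>K n. (\<eta> n h)\<^sup>2)"
      by (intro sum.cong) (auto simp: eq)
    also have "\<dots> = real N" using unit by (simp add: K_def)
    finally show ?thesis
      using finite_sum_le_infsum[OF b_summable[OF g(1)], of "Sigma {..<N} K"] K(1) by auto
  qed
  have "metrically_proper G S ell2 \<pi> b"
    unfolding metrically_proper_def
  proof
    fix v :: "nat \<times> 'g \<Rightarrow> real" assume v: "v \<in> carrier ell2"
    have "eventually (\<lambda>g. Z \<le> hnorm ell2 (\<pi> g v \<oplus>\<^bsub>ell2\<^esub> b g)) (word_length_at_top G S)" for Z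
    proof -
      \<comment> \<open>Chosen for the estimate \<open>\<parallel>b g\<parallel>\<^sup>2 \<le> 2 *
        \<parallel>\<pi> g v + b g\<parallel>\<^sup>2 + 2 * \<parallel>v\<parallel>\<^sup>2\<close>
        below, which then leaves \<open>Z\<^sup>2\<close>.\<close>
      obtain N :: nat where N: "2 * Z\<^sup>2 + 2 * (\<Sum>\<^sub>\<infinity>p. (v p)\<^sup>2) \<le> real N"
        using real_arch_simple by blast
      define B where "B = (\<Union>n<N. (\<lambda>(h, k). h \<otimes> inv k) ` (K n \<times> K n))"
      have "finite B" using K(1) by (auto simp: B_def)
      \<comment> \<open>Word length is bounded on the finite set \<open>B\<close>, so a length above
        \<open>M\<close> forces \<open>g \<notin> B\<close>.\<close>
      then obtain M where M: "\<And>g. g \<in> B \<Longrightarrow> word_length G S g \<le> M"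
        by (meson finite_imageI finite_nat_set_iff_bounded_le imageI)
      have "Z \<le> hnorm ell2 (\<pi> g v \<oplus>\<^bsub>ell2\<^esub> b g)" if g: "g \<in> carrier G" "g \<notin> B" for g
      proof -
        have v': "(\<lambda>p. (\<pi> g v p)\<^sup>2) summable_on UNIV" and vb: "(\<lambda>p. (\<pi> g v p + b g p)\<^sup>2) summable_on UNIV"
          using v g by (simp_all add: \<pi>_summable summable_on_square_add b_summable)
        have "(b g p)\<^sup>2 \<le> 2 * (\<pi> g v p + b g p)\<^sup>2 + 2 * (\<pi> g v p)\<^sup>2" for p
          using sum_squares_bound[of "\<pi> g v p + b g p" "- \<pi> g v p"]
          by (simp add: power2_eq_square algebra_simps)
        then have "(\<Sum>\<^sub>\<infinity>p. (b g p)\<^sup>2) \<le> (\<Sum>\<^sub>\<infinity>p. 2 * (\<pi> g v p + b g p)\<^sup>2 + 2 * (\<pi> g v p)\<^sup>2)"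
          using v' vb g by (intro infsum_mono b_summable summable_on_add summable_on_cmult_right) auto
        also have "\<dots> = 2 * (\<Sum>\<^sub>\<infinity>p. (\<pi> g v p + b g p)\<^sup>2) + 2 * (\<Sum>\<^sub>\<infinity>p. (\<pi> g v p)\<^sup>2)"
          using v' vb by (simp add: infsum_add infsum_cmult_right summable_on_cmult_right)
        also have "(\<Sum>\<^sub>\<infinity>p. (\<pi> g v p)\<^sup>2) = (\<Sum>\<^sub>\<infinity>p. (v p)\<^sup>2)"
          unfolding \<pi>_def by (rule infsum_reindex_bij_betw[OF bij_shift[OF g(1)]])
        finally have "Z\<^sup>2 \<le> (\<Sum>\<^sub>\<infinity>p. (\<pi> g v p + b g p)\<^sup>2)"
          using norm_b[of g N] g N by (simp add: B_def)
        then show ?thesis by (simp add: hnorm_ell2 real_le_rsqrt)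
      qed
      then show ?thesis
        unfolding word_length_at_top_def eventually_inf_principal
        by (intro eventually_filtercomapI[OF eventually_gt_at_top[of M], THEN eventually_mono])
          (use M in \<open>force simp: not_le[symmetric]\<close>)
    qed
    then show "filterlim (\<lambda>g. hnorm ell2 (\<pi> g v \<oplus>\<^bsub>ell2\<^esub> b g)) at_top (word_length_at_top G S)"
      by (simp add: filterlim_at_top)
  qed
  then show ?thesis by (rule a_T_menableI[OF G real_hilbert_ell2 act])
qed

section \<open>The invariant measure\<close>

text \<open>Division by \<open>c\<close> undoes multiplication when \<open>c\<close> is nonzero and
  finite. For \<open>c = \<infinity>\<close> positive values with infimum \<open>0\<close> are a
  counterexample, and for \<open>c = 0\<close> the empty infimum is.\<close>

lemma INF_mult_left_ennreal:
  assumes "c \<noteq> \<infinity>" "I \<noteq> {}"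
  shows "(c::ennreal) * (INF i\<in>I. f i) = (INF i\<in>I. c * f i)"
proof (cases "c = 0")
  case False
  show ?thesis
  proof (rule antisym)
    show "c * (INF i\<in>I. f i) \<le> (INF i\<in>I. c * f i)"
      by (intro INF_greatest mult_left_mono INF_lower) auto
    have "(INF i\<in>I. c * f i) / c \<le> (INF i\<in>I. f i)"
    proof (intro INF_greatest)
      fix i assume "i \<in> I"
      then have "(INF i\<in>I. c * f i) / c \<le> (c * f i) / c"
        by (intro divide_right_mono_ennreal INF_lower)
      also have "\<dots> = f i" using False assms(1)
        by (simp add: ennreal_mult_divide_eq mult.commute[of c])
      finally show "(INF i\<in>I. c * f i) / c \<le> f i" .
    qed
    then have "c * ((INF i\<in>I. c * f i) / c) \<le> c * (INF i\<in>I. f i)"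
      by (intro mult_left_mono) auto
    then show "(INF i\<in>I. c * f i) \<le> c * (INF i\<in>I. f i)"
      using False assms(1) by (simp add: ennreal_times_divide ennreal_mult_divide_eq mult.commute[of c])
  qed
qed (use assms in auto)

text \<open>Every element is a finite word in \<open>H\<close> and its inverses. Countability of the
  group makes the supremum and the infimum of the derivatives measurable and lets null sets be
  united over the group.\<close>

lemma (in group) countable_generate:
  assumes "countable H" "H \<subseteq> carrier G"
  shows "countable (generate G H)"
proof -
  define X where "X = H \<union> m_inv G ` H"
  have X: "X \<subseteq> carrier G" "countable X" using assms by (auto simp: X_def)
  have closed: "foldr (\<otimes>) ws \<one> \<in> carrier G" if "ws \<in> lists X" for ws
    using that X by (induction ws) auto
  have append: "foldr (\<otimes>) (us @ vs) \<one> = foldr (\<otimes>) us \<one> \<otimes> foldr (\<otimes>) vs \<one>"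
    if "us \<in> lists X" "vs \<in> lists X" for us vs
    using that(1)
  proof (induction us)
    case Nil
    show ?case using closed[OF that(2)] by simp
  next
    case (Cons x us)
    then show ?case using X closed[of us] closed[OF that(2)] by (simp add: m_assoc subset_iff)
  qed
  have "g \<in> (\<lambda>ws. foldr (\<otimes>) ws \<one>) ` lists X" if "g \<in> generate G H" for g
    using that
  proof induction
    case one
    show ?case by (rule image_eqI[of _ _ "[]"]) auto
  next
    case (incl h)
    then show ?case using assms by (intro image_eqI[of _ _ "[h]"]) (auto simp: X_def)
  next
    case (inv h)
    then show ?case using assms by (intro image_eqI[of _ _ "[inv h]"]) (auto simp: X_def)
  next
    case (eng g h)
    then obtain us vs where "us \<in> lists X" "g = foldr (\<otimes>) us \<one>" "vs \<in> lists X" "h = foldr (\<otimes>) vs \<one>"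
      by auto
    then show ?case by (intro image_eqI[of _ _ "us @ vs"]) (auto simp: append simp del: foldr_append)
  qed
  then have "generate G H \<subseteq> (\<lambda>ws. foldr (\<otimes>) ws \<one>) ` lists X" by blast
  moreover have "countable (lists X)" using X by blast
  ultimately show ?thesis by (meson countable_image countable_subset)
qed

text \<open>Change of variables: \<open>f\<close> equals \<open>f \<circ> T'\<close> composed with
  \<open>T\<close>, so its push-forward has density \<open>f \<circ> T'\<close> with respect to
  \<open>distr M M T\<close>, which in turn has density \<open>r\<close>.\<close>

lemma distr_density_push:
  assumes [measurable]: "T \<in> measurable M M" "T' \<in> measurable M M" "r \<in> borel_measurable M" "f \<in> borel_measurable M"
    and r: "density M r = distr M M T" and inv: "\<And>x. x \<in> space M \<Longrightarrow> T' (T x) = x"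
  shows "distr (density M f) M T = density M (\<lambda>x. r x * f (T' x))"
proof -
  have "density M (\<lambda>x. r x * f (T' x)) = density (density M r) (\<lambda>x. f (T' x))"
    by (simp add: density_density_eq)
  also have "\<dots> = distr (density M (\<lambda>x. f (T' (T x)))) M T"
    unfolding r by (rule density_distr) measurable
  also have "density M (\<lambda>x. f (T' (T x))) = density M f"
    using inv by (intro density_cong) auto
  finally show ?thesis ..
qed

text \<open>By \<open>distr_density_push\<close>, the identity
  \<open>w x = \<rho> g x * w (\<Phi> (inv g) x)\<close> says exactly that the measure with density
  \<open>w\<close> is invariant under \<open>g\<close>.\<close>

lemma exists_invariant_prob_space:
  fixes G :: "('g, 'n) monoid_scheme" (structure) and \<rho> :: "'g \<Rightarrow> 'x \<Rightarrow> ennreal"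
  assumes "prob_space \<nu>" and countable: "countable (carrier G)"
    and action: "group_action G (space \<nu>) \<Phi>"
    and [measurable]: "\<And>g. g \<in> carrier G \<Longrightarrow> \<Phi> g \<in> measurable \<nu> \<nu>"
      "\<And>g. g \<in> carrier G \<Longrightarrow> \<rho> g \<in> borel_measurable \<nu>"
    and deriv: "\<And>g. g \<in> carrier G \<Longrightarrow> density \<nu> (\<rho> g) = distr \<nu> \<nu> (\<Phi> g)"
    and integrals: "(\<integral>\<^sup>+x. (SUP g\<in>carrier G. \<rho> g x) \<partial>\<nu>) < \<infinity> \<or>
      (\<integral>\<^sup>+x. (INF g\<in>carrier G. \<rho> g x) \<partial>\<nu>) > 0"
  obtains \<mu> where "prob_space \<mu>" "sets \<mu> = sets \<nu>" "\<And>g. g \<in> carrier G \<Longrightarrow> distr \<mu> \<mu> (\<Phi> g) = \<mu>"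
proof -
  interpret prob_space \<nu> by fact
  interpret A: group_action G "space \<nu>" \<Phi> by (rule action)
  interpret group G using A.group_hom group_hom.axioms(1) by blast
  have \<Phi>_inv: "\<Phi> (inv g) (\<Phi> g x) = x" if "g \<in> carrier G" "x \<in> space \<nu>" for g x
    using A.orbit_sym_aux that by blast
  have push: "distr (density \<nu> f) \<nu> (\<Phi> g) = density \<nu> (\<lambda>x. \<rho> g x * f (\<Phi> (inv g) x))"
    if [measurable]: "f \<in> borel_measurable \<nu>" and [simp]: "g \<in> carrier G" for f g
    by (rule distr_density_push) (auto simp: deriv \<Phi>_inv)
  \<comment> \<open>Both sides are densities of the push-forward under
    \<open>\<Phi> (g \<otimes> h)\<close>, and densities are unique almost everywhere.\<close>
  have cocycle: "AE x in \<nu>. \<rho> (g \<otimes> h) x = \<rho> g x * \<rho> h (\<Phi> (inv g) x)"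
    if [simp]: "g \<in> carrier G" "h \<in> carrier G" for g h
  proof -
    have [measurable]: "\<rho> g \<in> borel_measurable \<nu>" "\<rho> h \<in> borel_measurable \<nu>" "\<Phi> (inv g) \<in> measurable \<nu> \<nu>"
      by simp_all
    have "density \<nu> (\<rho> (g \<otimes> h)) = distr (distr \<nu> \<nu> (\<Phi> h)) \<nu> (\<Phi> g)"
      by (simp add: deriv distr_distr) (intro distr_cong; simp add: A.composition_rule)
    also have "\<dots> = density \<nu> (\<lambda>x. \<rho> g x * \<rho> h (\<Phi> (inv g) x))"
      by (simp add: push flip: deriv)
    finally show ?thesis by (subst (asm) density_unique_iff) simp_all
  qed
  \<comment> \<open>This makes \<open>\<rho> g\<close> finite almost everywhere. Moreover
    \<open>\<rho> \<one>\<close>, of integral one, lies between infimum and supremum: the supremum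
    has positive integral and the infimum a finite one, which are the halves not assumed in
    \<open>integrals\<close>.\<close>
  have int_\<rho>: "(\<integral>\<^sup>+x. \<rho> g x \<partial>\<nu>) = 1" if "g \<in> carrier G" for g
  proof -
    have "(\<integral>\<^sup>+x. \<rho> g x \<partial>\<nu>) = emeasure (density \<nu> (\<rho> g)) (space \<nu>)"
      using that by (simp add: emeasure_density cong: nn_integral_cong)
    also have "\<dots> = 1"
      using that prob_space.emeasure_space_1[OF prob_space_distr, of "\<Phi> g" \<nu>] by (simp add: deriv)
    finally show ?thesis .
  qed
  \<comment> \<open>One null set serves all \<open>h\<close>, as \<open>G\<close> is
    countable.\<close>
  have AE_cocycle: "AE x in \<nu>. \<rho> g x \<noteq> \<infinity> \<and> (\<forall>h\<in>carrier G. \<rho> (g \<otimes> h) x = \<rho> g x * \<rho> h (\<Phi> (inv g) x))"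
    if g: "g \<in> carrier G" for g
  proof (rule AE_conjI)
    show "AE x in \<nu>. \<rho> g x \<noteq> \<infinity>"
      using g int_\<rho>[OF g] by (intro nn_integral_noteq_infinite) auto
    show "AE x in \<nu>. \<forall>h\<in>carrier G. \<rho> (g \<otimes> h) x = \<rho> g x * \<rho> h (\<Phi> (inv g) x)"
      using countable cocycle[OF g] by (simp add: AE_ball_countable)
  qed
  obtain w where w [measurable]: "w \<in> borel_measurable \<nu>"
    and pos: "(\<integral>\<^sup>+x. w x \<partial>\<nu>) \<noteq> 0" and fin: "(\<integral>\<^sup>+x. w x \<partial>\<nu>) \<noteq> \<infinity>"
    and w_cocycle: "\<And>g. g \<in> carrier G \<Longrightarrow> AE x in \<nu>. w x = \<rho> g x * w (\<Phi> (inv g) x)"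
    using integrals
  proof
    assume *: "(\<integral>\<^sup>+x. (SUP g\<in>carrier G. \<rho> g x) \<partial>\<nu>) < \<infinity>"
    show thesis
    proof (rule that[of "\<lambda>x. SUP g\<in>carrier G. \<rho> g x"])
      show "(\<lambda>x. SUP g\<in>carrier G. \<rho> g x) \<in> borel_measurable \<nu>"
        using countable by (intro borel_measurable_SUP) auto
      have "(\<integral>\<^sup>+x. \<rho> \<one> x \<partial>\<nu>) \<le> (\<integral>\<^sup>+x. (SUP g\<in>carrier G. \<rho> g x) \<partial>\<nu>)"
        by (intro nn_integral_mono SUP_upper) simp
      then show "(\<integral>\<^sup>+x. (SUP g\<in>carrier G. \<rho> g x) \<partial>\<nu>) \<noteq> 0" by (auto simp: int_\<rho>)
      show "AE x in \<nu>. (SUP h\<in>carrier G. \<rho> h x) = \<rho> g x * (SUP h\<in>carrier G. \<rho> h (\<Phi> (inv g) x))"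
        if g: "g \<in> carrier G" for g
        using AE_cocycle[OF g]
      proof eventually_elim
        case (elim x)
        \<comment> \<open>Left multiplication by \<open>g\<close> permutes the index set, so the
          cocycle identity can be applied to every term.\<close>
        have "(SUP h\<in>carrier G. \<rho> h x) = (SUP h\<in>(\<otimes>) g ` carrier G. \<rho> h x)"
          using g by (simp add: surj_const_mult)
        also have "\<dots> = (SUP h\<in>carrier G. \<rho> g x * \<rho> h (\<Phi> (inv g) x))"
          unfolding image_image using elim by (intro SUP_cong) auto
        finally show ?case by (simp add: SUP_mult_left_ennreal)
      qed
    qed (use * in auto)
  next
    assume *: "(\<integral>\<^sup>+x. (INF g\<in>carrier G. \<rho> g x) \<partial>\<nu>) > 0"
    show thesis
    proof (rule that[of "\<lambda>x. INF g\<in>carrier G. \<rho> g x"])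
      show "(\<lambda>x. INF g\<in>carrier G. \<rho> g x) \<in> borel_measurable \<nu>"
        using countable by (intro borel_measurable_INF) auto
      have "(\<integral>\<^sup>+x. (INF g\<in>carrier G. \<rho> g x) \<partial>\<nu>) \<le> (\<integral>\<^sup>+x. \<rho> \<one> x \<partial>\<nu>)"
        by (intro nn_integral_mono INF_lower) simp
      then show "(\<integral>\<^sup>+x. (INF g\<in>carrier G. \<rho> g x) \<partial>\<nu>) \<noteq> \<infinity>" by (auto simp: int_\<rho> top_unique)
      show "AE x in \<nu>. (INF h\<in>carrier G. \<rho> h x) = \<rho> g x * (INF h\<in>carrier G. \<rho> h (\<Phi> (inv g) x))"
        if g: "g \<in> carrier G" for g
        using AE_cocycle[OF g]
      proof eventually_elim
        case (elim x)
        have "(INF h\<in>carrier G. \<rho> h x) = (INF h\<in>(\<otimes>) g ` carrier G. \<rho> h x)"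
          using g by (simp add: surj_const_mult)
        also have "\<dots> = (INF h\<in>carrier G. \<rho> g x * \<rho> h (\<Phi> (inv g) x))"
          unfolding image_image using elim by (intro INF_cong) auto
        \<comment> \<open>Unlike a supremum, an infimum commutes only with finite factors; hence
          \<open>\<rho> g x \<noteq> \<infinity>\<close> in \<open>AE_cocycle\<close>.\<close>
        also have "\<dots> = \<rho> g x * (INF h\<in>carrier G. \<rho> h (\<Phi> (inv g) x))"
          using elim by (intro INF_mult_left_ennreal[symmetric]) auto
        finally show ?case .
      qed
    qed (use * in auto)
  qed
  define c where "c = (\<integral>\<^sup>+x. w x \<partial>\<nu>)"
  define \<mu> where "\<mu> = density \<nu> (\<lambda>x. w x / c)"
  have "emeasure \<mu> (space \<mu>) = c / c"
    by (simp add: \<mu>_def emeasure_density nn_integral_divide c_def cong: nn_integral_cong)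
  then have "prob_space \<mu>"
    using pos fin by (intro prob_spaceI) (simp add: c_def ennreal_divide_self less_top)
  moreover have sets: "sets \<mu> = sets \<nu>" by (simp add: \<mu>_def)
  moreover have "distr \<mu> \<mu> (\<Phi> g) = \<mu>" if g [simp]: "g \<in> carrier G" for g
  proof -
    have [measurable]: "\<rho> g \<in> borel_measurable \<nu>" "\<Phi> (inv g) \<in> measurable \<nu> \<nu>" by simp_all
    \<comment> \<open>The target enters \<open>distr\<close> only through its space and
      sigma-algebra; \<open>\<nu>\<close> is the target in \<open>push\<close>.\<close>
    have "distr \<mu> \<mu> (\<Phi> g) = distr \<mu> \<nu> (\<Phi> g)" by (rule distr_cong) (auto simp: sets)
    also have "\<dots> = density \<nu> (\<lambda>x. \<rho> g x * (w (\<Phi> (inv g) x) / c))"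
      by (simp add: \<mu>_def push)
    also have "\<dots> = \<mu>"
      unfolding \<mu>_def using w_cocycle[OF g]
      by (intro density_cong) (auto simp: ennreal_times_divide elim!: eventually_mono)
    finally show ?thesis .
  qed
  ultimately show thesis by (rule that)
qed

section \<open>Almost invariant vectors\<close>

text \<open>The integral of \<open>(f x - t * g x)\<^sup>2\<close> is a quadratic polynomial in
  \<open>t\<close> without negative values.\<close>

lemma integral_Cauchy_Schwarz:
  fixes f g :: "'a \<Rightarrow> real"
  assumes "integrable M (\<lambda>x. (f x)\<^sup>2)" "integrable M (\<lambda>x. (g x)\<^sup>2)" "integrable M (\<lambda>x. f x * g x)"
  shows "(\<integral>x. f x * g x \<partial>M) \<le> sqrt (\<integral>x. (f x)\<^sup>2 \<partial>M) * sqrt (\<integral>x. (g x)\<^sup>2 \<partial>M)"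
proof -
  define A B C where "A = (\<integral>x. (f x)\<^sup>2 \<partial>M)" and "B = (\<integral>x. f x * g x \<partial>M)" and "C = (\<integral>x. (g x)\<^sup>2 \<partial>M)"
  have quad: "0 \<le> A - 2 * t * B + t\<^sup>2 * C" for t
  proof -
    have "0 \<le> (\<integral>x. (f x - t * g x)\<^sup>2 \<partial>M)" by simp
    also have "(\<lambda>x. (f x - t * g x)\<^sup>2) = (\<lambda>x. (f x)\<^sup>2 - 2 * t * (f x * g x) + t\<^sup>2 * (g x)\<^sup>2)"
      by (simp add: power2_eq_square algebra_simps)
    also have "(\<integral>x. (f x)\<^sup>2 - 2 * t * (f x * g x) + t\<^sup>2 * (g x)\<^sup>2 \<partial>M) = A - 2 * t * B + t\<^sup>2 * C"
      using assms by (simp add: A_def B_def C_def)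
    finally show ?thesis .
  qed
  have "C \<ge> 0" by (simp add: C_def)
  have "B\<^sup>2 \<le> A * C"
  proof (cases "C = 0")
    case True
    have "B = 0"
    proof (rule ccontr)
      assume "B \<noteq> 0"
      \<comment> \<open>With \<open>C = 0\<close> the polynomial has the value \<open>- 1\<close> at
        this \<open>t\<close>.\<close>
      then show False using quad[of "(A + 1) / (2 * B)"] True by simp
    qed
    then show ?thesis using True by simp
  next
    case False
    \<comment> \<open>The polynomial has its minimum at \<open>B / C\<close>.\<close>
    then show ?thesis using quad[of "B / C"] \<open>C \<ge> 0\<close>
      by (simp add: power2_eq_square field_simps)
  qed
  then have "\<bar>B\<bar> \<le> sqrt (A * C)" by (rule real_le_rsqrt[of "\<bar>B\<bar>", simplified])
  then show ?thesis by (simp add: A_def B_def C_def real_sqrt_mult)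
qed

text \<open>Passing from \<open>\<xi> h\<close> to its norm in \<open>L\<^sub>2(\<mu>)\<close> keeps
  the total norm one and can only increase the correlations: Cauchy-Schwarz bounds each integrated
  product by the product of the norms, and invariance of \<open>\<mu>\<close> identifies the norm of
  a translate.\<close>

lemma almost_invariant_vectors_if_topologically_amenable:
  fixes G :: "('g, 'n) monoid_scheme" (structure) and \<Phi> :: "'g \<Rightarrow> 'x::topological_space \<Rightarrow> 'x"
  assumes "prob_space \<mu>" and borel: "sets \<mu> = sets borel" and compact: "compact (UNIV :: 'x set)"
    and G: "group G" and S: "S \<subseteq> carrier G"
    and cont: "\<And>g. g \<in> carrier G \<Longrightarrow> continuous_on UNIV (\<Phi> g)"
    and invariant: "\<And>g. g \<in> carrier G \<Longrightarrow> distr \<mu> \<mu> (\<Phi> g) = \<mu>"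
    and amenable: "topologically_amenable G S \<Phi>" and \<epsilon>: "\<epsilon> > 0"
  shows "\<exists>\<eta> :: 'g \<Rightarrow> real.
      finite {h. \<eta> h \<noteq> 0} \<and> {h. \<eta> h \<noteq> 0} \<subseteq> carrier G \<and> (\<Sum>h | \<eta> h \<noteq> 0. (\<eta> h)\<^sup>2) = 1 \<and>
      (\<Sum>s\<in>S. 1 - (\<Sum>h | \<eta> h \<noteq> 0. \<eta> h * \<eta> (inv s \<otimes> h))) \<le> \<epsilon>"
proof -
  interpret prob_space \<mu> by fact
  interpret group G by (rule G)
  \<comment> \<open>Amenability bounds an average over \<open>S\<close>, the claim a sum. The
    \<open>+ 1\<close> keeps \<open>\<delta>\<close> positive when
    \<open>card S = 0\<close>.\<close>
  define \<delta> where "\<delta> = \<epsilon> / (real (card S) + 1)"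
  have "\<delta> > 0" using \<epsilon> by (simp add: \<delta>_def)
  then obtain \<xi> where \<xi>: "\<xi> \<in> finsupp_C G" and nonneg: "\<And>g x. g \<in> carrier G \<Longrightarrow> \<xi> g x \<ge> 0"
    and unit: "\<And>x. inner_C G \<xi> \<xi> x = 1"
    and sup: "(SUP x. 1 - 1 / real (card S) * (\<Sum>s\<in>S. inner_C G \<xi> (left_translate G \<Phi> s \<xi>) x)) \<le> \<delta>"
    using amenable unfolding topologically_amenable_def by meson
  define F where "F = {g \<in> carrier G. \<xi> g \<noteq> (\<lambda>x. 0)}"
  have F: "finite F" "F \<subseteq> carrier G" and \<xi>_cont: "\<And>g. g \<in> carrier G \<Longrightarrow> continuous_on UNIV (\<xi> g)"
    using \<xi> by (auto simp: finsupp_C_def F_def)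
  have integrable: "integrable \<mu> f" if f: "continuous_on UNIV f" for f :: "'x \<Rightarrow> real"
  proof -
    obtain B where "\<And>x. \<bar>f x\<bar> \<le> B"
      using compact_imp_bounded[OF compact_continuous_image[OF f compact]] by (auto simp: bounded_iff)
    moreover have "f \<in> borel_measurable \<mu>"
      using borel_measurable_continuous_onI[OF f] borel by (simp cong: measurable_cong_sets)
    ultimately show ?thesis by (intro integrable_const_bound[of _ B]) auto
  qed
  have \<Phi>_meas: "\<Phi> g \<in> measurable \<mu> \<mu>" if "g \<in> carrier G" for g
    using borel_measurable_continuous_onI[OF cont[OF that]] borel by (simp cong: measurable_cong_sets)
  have L_cont: "continuous_on UNIV (left_translate G \<Phi> s \<xi> h)" if "s \<in> carrier G" "h \<in> carrier G" for s h
    unfolding left_translate_def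
    by (rule continuous_on_compose2[OF \<xi>_cont cont]) (use that in auto)
  define I where "I s x = inner_C G \<xi> (left_translate G \<Phi> s \<xi>) x" for s x
  have I: "I s x = (\<Sum>h\<in>F. \<xi> h x * left_translate G \<Phi> s \<xi> h x)" for s x
    by (simp add: I_def inner_C_def F_def)
  have I_nonneg: "I s x \<ge> 0" if "s \<in> S" for s x
    unfolding I using that S F by (intro sum_nonneg mult_nonneg_nonneg) (auto simp: left_translate_def intro!: nonneg)
  have I_integrable: "integrable \<mu> (I s)" if "s \<in> S" for s
    unfolding I using that S F by (intro integrable continuous_intros L_cont \<xi>_cont) auto
  have pointwise: "(\<Sum>s\<in>S. 1 - I s x) \<le> \<epsilon>" for x
  proof -
    \<comment> \<open>A real supremum is known to dominate its members only if they are bounded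
      above; the bound \<open>1\<close> comes from \<open>I_nonneg\<close>.\<close>
    have "1 - 1 / real (card S) * (\<Sum>s\<in>S. I s x) \<le> \<delta>"
    proof (rule order_trans[OF cSUP_upper sup[folded I_def]])
      have "1 - 1 / real (card S) * (\<Sum>s\<in>S. I s x) \<le> 1" for x
        using I_nonneg by (simp add: sum_nonneg)
      then show "bdd_above (range (\<lambda>x. 1 - 1 / real (card S) * (\<Sum>s\<in>S. I s x)))"
        by (intro bdd_aboveI[of _ 1]) auto
    qed simp
    then have "real (card S) * (1 - 1 / real (card S) * (\<Sum>s\<in>S. I s x)) \<le> real (card S) * \<delta>"
      by (intro mult_left_mono) auto
    also have "real (card S) * \<delta> \<le> \<epsilon>" using \<epsilon> by (simp add: \<delta>_def field_simps)
    \<comment> \<open>If \<open>card S = 0\<close>, then \<open>S\<close> is empty or infinite and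
      the sum is \<open>0\<close> by convention; otherwise the factor \<open>card S\<close>
      cancels.\<close>
    finally show ?thesis
      by (cases "card S = 0") (auto simp: sum_subtractf algebra_simps card_eq_0_iff)
  qed

  define \<eta> where "\<eta> h = (if h \<in> carrier G then sqrt (\<integral>x. (\<xi> h x)\<^sup>2 \<partial>\<mu>) else 0)" for h
  have supp: "{h. \<eta> h \<noteq> 0} \<subseteq> F" by (auto simp: \<eta>_def F_def)
  have \<eta>_sq: "(\<eta> h)\<^sup>2 = (\<integral>x. (\<xi> h x)\<^sup>2 \<partial>\<mu>)" if "h \<in> carrier G" for h
    using that by (simp add: \<eta>_def)
  have "(\<Sum>h | \<eta> h \<noteq> 0. (\<eta> h)\<^sup>2) = (\<Sum>h\<in>F. (\<eta> h)\<^sup>2)"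
    using F supp by (intro sum.mono_neutral_left) auto
  also have "\<dots> = (\<Sum>h\<in>F. \<integral>x. (\<xi> h x)\<^sup>2 \<partial>\<mu>)"
    using F \<eta>_sq by (intro sum.cong) auto
  also have "\<dots> = (\<integral>x. (\<Sum>h\<in>F. (\<xi> h x)\<^sup>2) \<partial>\<mu>)"
    using F by (intro Bochner_Integration.integral_sum[symmetric] integrable continuous_intros \<xi>_cont) auto
  also have "(\<lambda>x. \<Sum>h\<in>F. (\<xi> h x)\<^sup>2) = (\<lambda>x. 1)"
    using unit by (simp add: inner_C_def F_def power2_eq_square)
  finally have \<eta>_unit: "(\<Sum>h | \<eta> h \<noteq> 0. (\<eta> h)\<^sup>2) = 1" by (simp add: prob_space)

  have corr: "(\<integral>x. I s x \<partial>\<mu>) \<le> (\<Sum>h | \<eta> h \<noteq> 0. \<eta> h * \<eta> (inv s \<otimes> h))" if s: "s \<in> S" for s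
  proof -
    have sG: "s \<in> carrier G" using s S by blast
    have "(\<integral>x. I s x \<partial>\<mu>) = (\<Sum>h\<in>F. \<integral>x. \<xi> h x * left_translate G \<Phi> s \<xi> h x \<partial>\<mu>)"
      unfolding I using F sG by (intro Bochner_Integration.integral_sum integrable continuous_intros L_cont \<xi>_cont) auto
    also have "\<dots> \<le> (\<Sum>h\<in>F. \<eta> h * \<eta> (inv s \<otimes> h))"
    proof (rule sum_mono)
      fix h assume "h \<in> F"
      then have h: "h \<in> carrier G" using F by blast
      have k: "inv s \<otimes> h \<in> carrier G" using sG h by simp
      have meas: "(\<lambda>x. (\<xi> (inv s \<otimes> h) x)\<^sup>2) \<in> borel_measurable \<mu>"
        by (intro borel_measurable_integrable integrable continuous_intros \<xi>_cont k)
      \<comment> \<open>Invariance of \<open>\<mu>\<close> enters here, through the substitution by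
        \<open>\<Phi> (inv s)\<close>.\<close>
      have "(\<integral>x. (left_translate G \<Phi> s \<xi> h x)\<^sup>2 \<partial>\<mu>)
          = (\<integral>x. (\<xi> (inv s \<otimes> h) x)\<^sup>2 \<partial>distr \<mu> \<mu> (\<Phi> (inv s)))"
        unfolding left_translate_def using sG by (intro integral_distr[symmetric] \<Phi>_meas meas) auto
      then have L_sq: "(\<integral>x. (left_translate G \<Phi> s \<xi> h x)\<^sup>2 \<partial>\<mu>) = (\<integral>x. (\<xi> (inv s \<otimes> h) x)\<^sup>2 \<partial>\<mu>)"
        using sG by (simp add: invariant)
      have "(\<integral>x. \<xi> h x * left_translate G \<Phi> s \<xi> h x \<partial>\<mu>)
          \<le> sqrt (\<integral>x. (\<xi> h x)\<^sup>2 \<partial>\<mu>) * sqrt (\<integral>x. (left_translate G \<Phi> s \<xi> h x)\<^sup>2 \<partial>\<mu>)"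
        using h sG by (intro integral_Cauchy_Schwarz integrable continuous_intros L_cont \<xi>_cont) auto
      then show "(\<integral>x. \<xi> h x * left_translate G \<Phi> s \<xi> h x \<partial>\<mu>) \<le> \<eta> h * \<eta> (inv s \<otimes> h)"
        using h k by (simp add: L_sq \<eta>_def)
    qed
    also have "\<dots> = (\<Sum>h | \<eta> h \<noteq> 0. \<eta> h * \<eta> (inv s \<otimes> h))"
      using F supp by (intro sum.mono_neutral_right) auto
    finally show ?thesis .
  qed
  have "(\<Sum>s\<in>S. 1 - (\<Sum>h | \<eta> h \<noteq> 0. \<eta> h * \<eta> (inv s \<otimes> h))) \<le> (\<Sum>s\<in>S. 1 - (\<integral>x. I s x \<partial>\<mu>))"
    using corr by (intro sum_mono) simp
  also have "\<dots> = (\<integral>x. (\<Sum>s\<in>S. 1 - I s x) \<partial>\<mu>)"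
    using I_integrable by (simp add: prob_space)
  also have "\<dots> \<le> (\<integral>x. \<epsilon> \<partial>\<mu>)"
    using pointwise I_integrable by (intro integral_mono) auto
  finally have "(\<Sum>s\<in>S. 1 - (\<Sum>h | \<eta> h \<noteq> 0. \<eta> h * \<eta> (inv s \<otimes> h))) \<le> \<epsilon>"
    by (simp add: prob_space)
  then show ?thesis using \<eta>_unit supp F by (intro exI[of _ \<eta>]) (auto intro: finite_subset)
qed

text \<open>With values in \<open>ennreal\<close>, supremum and infimum of the derivatives always
  exist, and integrability is finiteness of the integral. The density equation fixes each
  \<open>\<rho> g\<close> up to a null set; as \<open>G\<close> is countable, this fixes the
  supremum and the infimum up to a null set as well.\<close>

theorem corollary4:
  fixes G :: "('g, 'n) monoid_scheme" and S :: "'g set"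
    and \<Phi> :: "'g \<Rightarrow> 'x::t2_space \<Rightarrow> 'x" and \<nu> :: "'x measure"
    and \<rho> :: "'g \<Rightarrow> 'x \<Rightarrow> ennreal"
  assumes group: "group G"
    and generating: "finite S" "S \<subseteq> carrier G" "generate G S = carrier G"
    and symmetric: "\<And>s. s \<in> S \<Longrightarrow> inv\<^bsub>G\<^esub> s \<in> S"
    and compact: "compact (UNIV :: 'x set)"
    and action: "group_action G UNIV \<Phi>"
    and homeo: "\<And>g. g \<in> carrier G \<Longrightarrow> homeomorphic_map euclidean euclidean (\<Phi> g)"
    and prob: "prob_space \<nu>" and borel: "sets \<nu> = sets borel"
    and preserved: "measure_class_preserved G \<Phi> \<nu>"
    and deriv_measurable: "\<And>g. g \<in> carrier G \<Longrightarrow> \<rho> g \<in> borel_measurable \<nu>"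
    and deriv: "\<And>g. g \<in> carrier G \<Longrightarrow> density \<nu> (\<rho> g) = translate_measure G \<Phi> g \<nu>"
    and bounded: "\<And>s. s \<in> S \<Longrightarrow> \<exists>C::real. AE x in \<nu>. \<rho> s x \<le> ennreal C"
    and integrals: "(\<integral>\<^sup>+x. (SUP g\<in>carrier G. \<rho> g x) \<partial>\<nu>) < \<infinity> \<or>
      (\<integral>\<^sup>+x. (INF g\<in>carrier G. \<rho> g x) \<partial>\<nu>) > 0"
    and not_a_T_menable: "\<not> a_T_menable G S"
  shows "\<not> topologically_amenable G S \<Phi>"
proof
  assume amenable: "topologically_amenable G S \<Phi>"
  have space: "space \<nu> = UNIV" using sets_eq_imp_space_eq[OF borel] by simp
  have cont: "continuous_on UNIV (\<Phi> g)" if "g \<in> carrier G" for g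
    using homeomorphic_imp_continuous_map[OF homeo[OF that]] by simp
  have meas: "\<Phi> g \<in> measurable \<nu> \<nu>" if "g \<in> carrier G" for g
    using borel_measurable_continuous_onI[OF cont[OF that]] borel by (simp cong: measurable_cong_sets)
  have distr: "density \<nu> (\<rho> g) = distr \<nu> \<nu> (\<Phi> g)" if "g \<in> carrier G" for g
    using deriv[OF that] translate_measure_eq_distr[of G \<nu> \<Phi> g] action that meas[OF that] by (simp add: space)
  have "countable (carrier G)"
    using group.countable_generate[OF group countable_finite[OF generating(1)] generating(2)]
    by (simp add: generating(3))
  then obtain \<mu> where \<mu>: "prob_space \<mu>" "sets \<mu> = sets \<nu>" "\<And>g. g \<in> carrier G \<Longrightarrow> distr \<mu> \<mu> (\<Phi> g) = \<mu>"
    using exists_invariant_prob_space[OF prob _ _ meas deriv_measurable distr integrals] action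
    by (auto simp: space)
  have "a_T_menable G S"
    by (rule a_T_menable_if_almost_invariant_vectors[OF group generating(2,3,1)],
        rule almost_invariant_vectors_if_topologically_amenable[OF \<mu>(1) _ compact group generating(2)
          cont \<mu>(3) amenable])
      (simp_all add: \<mu>(2) borel)
  with not_a_T_menable show False ..
qed

end
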